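(* Let $\mathcal U$ be the uniform distribution on the $n$-qubit Clifford group $\mathrm{Cl}_n$, let $\rho$ be a density operator and $O$ a traceless Hermitian operator on $\mathcal H$. Then $$V_*(O,\rho)=V_\triangle(O,\rho)-\frac{[\operatorname{tr}(O\rho)]^2}{d+2}\le V_\triangle(O,\rho)\le\frac{2(d+1)}{d(d+2)}\|\Xi_{\rho,O}\|_2^2\le\frac{2(d+1)}{d+2}\|O\|_2^2.$$
   Context: Let $n\ge1$, $d=2^n$, $\mathcal H=(\mathbb C^2)^{\otimes n}$ with computational basis $\{|\mathbf b\rangle\}$. For a unitary ensemble $\mathcal U$ (probability distribution on $U(d)$) with measurement channel $\mathcal M(X)=\mathbb E_{U}\sum_{\mathbf b}\langle\mathbf b|UXU^\dagger|\mathbf b\rangle U^\dagger|\mathbf b\rangle\langle\mathbf b|U$ (for a 2-design, $\mathcal M^{-1}(O)=(d+1)O-\operatorname{tr}(O)\mathbb 1$), define for a density operator $\rho$ and traceless Hermitian $O$: $V_*(O,\rho)=\mathbb E_{U}\bigl(\sum_{\mathbf b}\langle\mathbf b|U\rho U^\dagger|\mathbf b\rangle\langle\mathbf b|U\mathcal M^{-1}(O)U^\dagger|\mathbf b\rangle\bigr)^2-[\operatorname{tr}(O\rho)]^2$. The Clifford group $\mathrm{Cl}_n$ is the group of unitaries $U$ with $U\mathcal P_nU^\dagger=\mathcal P_n$, where $\mathcal P_n$ is the $n$-qubit Pauli group (finite modulo phases; phases are irrelevant here). Let $\overline{\mathcal P}_n=\{I,X,Y,Z\}^{\otimes n}$ ($d^2$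 operators). For operators $A,B$ define functions on $\overline{\mathcal P}_n$: $\Xi_A(P)=\operatorname{tr}(AP)$, $\Xi_{A,B}(P)=\operatorname{tr}(AP)\operatorname{tr}(BP)$, $\tilde\Xi_{A,B}(P)=\operatorname{tr}(APBP)$, viewed as vectors in $\mathbb R^{d^2}$ with $\ell_p$ norms $\|\cdot\|_p$ and inner product $\cdot$. Define $V_\triangle(O,\rho)=\frac{d+1}{d(d+2)}\bigl(\|\Xi_{\rho,O}\|_2^2+\tilde\Xi_{\rho,O}\cdot\Xi_{\rho,O}\bigr)$. $\|O\|_2$ is the Hilbert–Schmidt norm. *)

theory Defs
  imports Complex_Main "Jordan_Normal_Form.Matrix"
begin

definition mtrace :: "complex mat \<Rightarrow> complex" where
  "mtrace A = (\<Sum>i<dim_row A. A $$ (i,i))"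

definition adj :: "complex mat \<Rightarrow> complex mat" where
  "adj A = mat (dim_col A) (dim_row A) (\<lambda>(i,j). cnj (A $$ (j,i)))"

definition hermitian :: "complex mat \<Rightarrow> bool" where
  "hermitian A \<longleftrightarrow> A = adj A"

definition unitary :: "nat \<Rightarrow> complex mat \<Rightarrow> bool" where
  "unitary d U \<longleftrightarrow> U \<in> carrier_mat d d \<and> adj U * U = 1\<^sub>m d \<and> U * adj U = 1\<^sub>m d"

definition density_op :: "nat \<Rightarrow> complex mat \<Rightarrow> bool" where
  "density_op d \<rho> \<longleftrightarrow> \<rho> \<in> carrier_mat d d \<and> hermitian \<rho> \<and>
     (\<forall>v \<in> carrier_vec d. 0 \<le> Re (conjugate v \<bullet> (\<rho> *\<^sub>v v))) \<and> mtrace \<rho> = 1"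

text \<open>Single-qubit Paulis: 0 = I, 1 = X, 2 = Y, 3 = Z; entry (a,b) with a,b in {0,1}.\<close>
definition sigma :: "nat \<Rightarrow> nat \<Rightarrow> nat \<Rightarrow> complex" where
  "sigma p a b =
    (if p = 0 then (if a = b then 1 else 0)
     else if p = 1 then (if a \<noteq> b then 1 else 0)
     else if p = 2 then (if a = b then 0 else if a = 0 then -\<i> else \<i>)
     else (if a \<noteq> b then 0 else if a = 0 then 1 else -1))"

definition qbit :: "nat \<Rightarrow> nat \<Rightarrow> nat" where
  "qbit k i = i div 2 ^ k mod 2"

text \<open>Labels of the d^2 Pauli strings {I,X,Y,Z}^{\<otimes> n} (extensional functions).\<close>
definition pauli_labels :: "nat \<Rightarrow> (nat \<Rightarrow> nat) set" where
  "pauli_labels n = {p. \<forall>k. (k < n \<longrightarrow> p k < 4) \<and> (n \<le> k \<longrightarrow> p k = 0)}"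

text \<open>The tensor product Pauli matrix; computational basis index i has qubit k equal to qbit k i.\<close>
definition pauli :: "nat \<Rightarrow> (nat \<Rightarrow> nat) \<Rightarrow> complex mat" where
  "pauli n p = mat (2^n) (2^n) (\<lambda>(i,j). \<Prod>k<n. sigma (p k) (qbit k i) (qbit k j))"

definition clifford :: "nat \<Rightarrow> complex mat set" where
  "clifford n = {U. unitary (2^n) U \<and>
     (\<forall>p \<in> pauli_labels n. \<exists>c q. c \<in> {1, -1, \<i>, -\<i>} \<and> q \<in> pauli_labels n \<and>
         U * pauli n p * adj U = c \<cdot>\<^sub>m pauli n q)}"

definition phase_rel :: "nat \<Rightarrow> (complex mat \<times> complex mat) set" where
  "phase_rel n = {(U,V). U \<in> clifford n \<and> V \<in> clifford n \<and>
      (\<exists>c. cmod c = 1 \<and> U = c \<cdot>\<^sub>m V)}"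

text \<open>Expectation under the uniform distribution on Cl_n (modulo phases) of a
  phase-invariant function f.\<close>
definition cliff_avg :: "nat \<Rightarrow> (complex mat \<Rightarrow> complex) \<Rightarrow> complex" where
  "cliff_avg n f = (\<Sum>C \<in> clifford n // phase_rel n. f (SOME U. U \<in> C))
                     / of_nat (card (clifford n // phase_rel n))"

text \<open>M(X) = E_U sum_b <b|U X U^dag|b> U^dag |b><b| U, written entrywise.\<close>
definition meas_channel :: "nat \<Rightarrow> complex mat \<Rightarrow> complex mat" where
  "meas_channel n X = mat (2^n) (2^n) (\<lambda>(i,j).
     cliff_avg n (\<lambda>U. \<Sum>b<2^n. (U * X * adj U) $$ (b,b) * (cnj (U $$ (b,i)) * U $$ (b,j))))"

definition meas_channel_inv :: "nat \<Rightarrow> complex mat \<Rightarrow> complex mat" where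
  "meas_channel_inv n Obs = (THE Y. Y \<in> carrier_mat (2^n) (2^n) \<and> meas_channel n Y = Obs)"

definition V_star :: "nat \<Rightarrow> complex mat \<Rightarrow> complex mat \<Rightarrow> real" where
  "V_star n Obs \<rho> = Re (cliff_avg n (\<lambda>U.
      (\<Sum>b<2^n. (U * \<rho> * adj U) $$ (b,b) * (U * meas_channel_inv n Obs * adj U) $$ (b,b))\<^sup>2))
    - (Re (mtrace (Obs * \<rho>)))\<^sup>2"

definition Xi1 :: "nat \<Rightarrow> complex mat \<Rightarrow> (nat \<Rightarrow> nat) \<Rightarrow> complex" where
  "Xi1 n A p = mtrace (A * pauli n p)"

definition Xi2 :: "nat \<Rightarrow> complex mat \<Rightarrow> complex mat \<Rightarrow> (nat \<Rightarrow> nat) \<Rightarrow> complex" where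
  "Xi2 n A B p = mtrace (A * pauli n p) * mtrace (B * pauli n p)"

definition Xi2t :: "nat \<Rightarrow> complex mat \<Rightarrow> complex mat \<Rightarrow> (nat \<Rightarrow> nat) \<Rightarrow> complex" where
  "Xi2t n A B p = mtrace (A * pauli n p * B * pauli n p)"

definition l2sq :: "nat \<Rightarrow> ((nat \<Rightarrow> nat) \<Rightarrow> complex) \<Rightarrow> real" where
  "l2sq n f = (\<Sum>p \<in> pauli_labels n. (cmod (f p))\<^sup>2)"

definition pdot :: "nat \<Rightarrow> ((nat \<Rightarrow> nat) \<Rightarrow> complex) \<Rightarrow> ((nat \<Rightarrow> nat) \<Rightarrow> complex) \<Rightarrow> real" where
  "pdot n f g = Re (\<Sum>p \<in> pauli_labels n. f p * g p)"

definition V_tri :: "nat \<Rightarrow> complex mat \<Rightarrow> complex mat \<Rightarrow> real" where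
  "V_tri n Obs \<rho> = (real (2^n) + 1) / (real (2^n) * (real (2^n) + 2)) *
     (l2sq n (Xi2 n \<rho> Obs) + pdot n (Xi2t n \<rho> Obs) (Xi2 n \<rho> Obs))"

definition hs_sq :: "complex mat \<Rightarrow> real" where
  "hs_sq A = (\<Sum>i<dim_row A. \<Sum>j<dim_col A. (cmod (A $$ (i,j)))\<^sup>2)"

end

theory Submission
  imports Defs
begin

text \<open>
  A Clifford unitary \<open>U\<close> permutes the Pauli strings up to sign; let \<open>L\<close> be the set of those it
  sends to strings over \<open>I, Z\<close>. Expanding in the Pauli basis gives
  \<open>\<Sum>b. (U A U*)\<^sub>b\<^sub>b (U B U*)\<^sub>b\<^sub>b = 1/d \<Sum>P\<in>L. tr (A P) tr (B P)\<close>, the signs occurring twice. Hence the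
  measurement channel and \<open>V\<^sub>*\<close> only involve the probabilities that \<open>P \<in> L\<close> and that \<open>P, Q \<in> L\<close>.
  The Clifford unitaries \<open>(P + Q) / sqrt 2\<close> with \<open>P, Q\<close> anticommuting act transitively enough on
  commuting pairs to make these probabilities constant; since \<open>L\<close> has \<open>d\<close> pairwise commuting
  elements, counting yields \<open>1/(d+1)\<close> and \<open>2/((d+1)(d+2))\<close>. The sum over commuting pairs is evaluated
  with the commutation characters, whose matrix is \<open>d\<close> times an orthogonal one; this also gives
  the second inequality. The third holds as \<open>\<bar>tr (\<rho> P)\<bar> \<le> 1\<close>.
\<close>

subsection \<open>Pauli labels\<close>

text \<open>The square in \<open>V_star\<close> has degree four in \<open>U\<close> and in its
  conjugate, and the Clifford group is not a unitary 4-design, so Haar integrals do not give this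
  average; hence the Pauli functions in the answer. Origin of the probabilities: \<open>L\<close>
  contains the identity and \<open>d - 1\<close> further strings, spread evenly over the
  \<open>d^2 - 1\<close> non-identity ones, which gives \<open>1/(d+1)\<close>. Once
  \<open>P\<close> is in \<open>L\<close>, the \<open>d - 2\<close> elements of \<open>L\<close>
  other than the identity and \<open>P\<close> are spread evenly over the \<open>d^2/2 - 2\<close>
  further strings that commute with \<open>P\<close>, which gives the second factor
  \<open>(d-2)/(d^2/2-2) = 2/(d+2)\<close>. The cases of equal, of distinct commuting and of
  anticommuting \<open>P, Q\<close> fit one weight, \<open>1 + lcomm + d [P = Q]\<close> over
  \<open>(d+1)(d+2)\<close>. Its three summands produce the three terms of the result: the squared
  trace, the product of the twisted and the plain Pauli function, and the squared norm. The weight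
  is wrong at the identity string, but there the summand vanishes because \<open>O\<close> is
  traceless.\<close>

lemma qbit_less_2: "qbit k i < 2"
  by (simp add: qbit_def)

lemma qbit_add_power:
  assumes "k < n"
  shows "qbit k (i + 2 ^ n) = qbit k i"
proof -
  obtain m where m: "n = Suc (k + m)" using assms less_iff_Suc_add by auto
  have "(2::nat) ^ n = 2 ^ k * (2 * 2 ^ m)" by (simp add: m power_add)
  then have "(i + 2 ^ n) div 2 ^ k = i div 2 ^ k + 2 * 2 ^ m" by simp
  then show ?thesis by (simp add: qbit_def)
qed

lemma qbit_top:
  assumes "i < 2 ^ n"
  shows "qbit n i = 0" "qbit n (i + 2 ^ n) = 1"
  using assms by (simp_all add: qbit_def)

lemma qbit_eqI:
  assumes "i < 2 ^ n" "j < 2 ^ n" "\<And>k. k < n \<Longrightarrow> qbit k i = qbit k j"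
  shows "i = j"
proof (rule bit_eqI)
  fix k
  show "bit i k = bit j k"
  proof (cases "k < n")
    case True
    then show ?thesis using assms(3)[of k]
      by (simp add: qbit_def bit_iff_odd odd_iff_mod_2_eq_one)
  next
    case False
    then have "(2::nat) ^ n \<le> 2 ^ k" by simp
    then have "i < 2 ^ k" "j < 2 ^ k" using assms by linarith+
    then show ?thesis by (simp add: bit_iff_odd)
  qed
qed

text \<open>Distributivity over the bits of the index. Entries of Pauli strings are products over
  qubits, so this reduces products and traces of strings to identities between 2 by 2
  matrices.\<close>

lemma sum_prod_qbit:
  fixes f :: "nat \<Rightarrow> nat \<Rightarrow> 'a::comm_semiring_1"
  shows "(\<Sum>i<2 ^ n. \<Prod>k<n. f k (qbit k i)) = (\<Prod>k<n. f k 0 + f k 1)"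
proof (induction n)
  case (Suc n)
  let ?g = "\<lambda>i. \<Prod>k<Suc n. f k (qbit k i)"
  \<comment> \<open>The two halves are the indices whose top qubit is 0 and 1.\<close>
  have split: "{..<2 ^ Suc n} = {..<2 ^ n} \<union> (\<lambda>i. i + 2 ^ n) ` {..<2 ^ n :: nat}"
  proof -
    have "i \<in> (\<lambda>i. i + 2 ^ n) ` {..<2 ^ n :: nat}" if "i < 2 ^ Suc n" "\<not> i < 2 ^ n" for i
      using that by (intro image_eqI[of _ _ "i - 2 ^ n"]) auto
    then show ?thesis by auto
  qed
  have "(\<Sum>i<2 ^ Suc n. ?g i) = (\<Sum>i<2 ^ n. ?g i) + (\<Sum>i\<in>(\<lambda>i. i + 2 ^ n) ` {..<2 ^ n}. ?g i)"
    unfolding split by (rule sum.union_disjoint) auto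
  also have "(\<Sum>i\<in>(\<lambda>i. i + 2 ^ n) ` {..<2 ^ n}. ?g i) = (\<Sum>i<2 ^ n. ?g (i + 2 ^ n))"
    by (subst sum.reindex) (auto simp: inj_on_def)
  also have "\<dots> = (\<Sum>i<2 ^ n. (\<Prod>k<n. f k (qbit k i)) * f n 1)"
    by (intro sum.cong refl) (simp add: qbit_add_power qbit_top)
  also have "(\<Sum>i<2 ^ n. ?g i) = (\<Sum>i<2 ^ n. (\<Prod>k<n. f k (qbit k i)) * f n 0)"
    by (intro sum.cong refl) (simp add: qbit_top)
  finally show ?case
    by (simp add: Suc.IH distrib_left flip: sum_distrib_right)
qed simp

lemma pauli_labels_Suc:
  "pauli_labels (Suc n) = (\<lambda>(p, s). p(n := s)) ` (pauli_labels n \<times> {..<4})"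
proof
  show "pauli_labels (Suc n) \<subseteq> (\<lambda>(p, s). p(n := s)) ` (pauli_labels n \<times> {..<4})"
  proof
    fix p assume "p \<in> pauli_labels (Suc n)"
    then have "(p(n := 0), p n) \<in> pauli_labels n \<times> {..<4}" "p = (p(n := 0))(n := p n)"
      by (auto simp: pauli_labels_def)
    then show "p \<in> (\<lambda>(p, s). p(n := s)) ` (pauli_labels n \<times> {..<4})"
      by (metis (no_types, lifting) case_prod_conv image_eqI)
  qed
qed (auto simp: pauli_labels_def)

lemma inj_on_upd_labels:
  "inj_on (\<lambda>(p, s). p(n := s)) (pauli_labels n \<times> {..<4})"
proof (rule inj_onI, clarify)
  fix p q :: "nat \<Rightarrow> nat" and s t
  assume pq: "p \<in> pauli_labels n" "q \<in> pauli_labels n" and eq: "p(n := s) = q(n := t)"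
  have "p k = q k" for k
    using fun_cong[OF eq, of k] pq by (cases "k = n") (auto simp: pauli_labels_def)
  then show "p = q \<and> s = t" using fun_cong[OF eq, of n] by auto
qed

lemma finite_pauli_labels [simp]: "finite (pauli_labels n)"
proof (induction n)
  case 0
  have "pauli_labels 0 = {\<lambda>_. 0}" by (auto simp: pauli_labels_def)
  then show ?case by simp
qed (simp add: pauli_labels_Suc)

text \<open>The analogue of \<open>sum_prod_qbit\<close> for sums over strings: character sums,
  completeness and the count of diagonal strings all become computations with four labels.\<close>

lemma sum_prod_labels:
  fixes f :: "nat \<Rightarrow> nat \<Rightarrow> 'a::comm_semiring_1"
  shows "(\<Sum>p\<in>pauli_labels n. \<Prod>k<n. f k (p k)) = (\<Prod>k<n. \<Sum>s<4. f k s)"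
proof (induction n)
  case 0
  have "pauli_labels 0 = {\<lambda>_. 0}" by (auto simp: pauli_labels_def)
  then show ?case by simp
next
  case (Suc n)
  have "(\<Sum>p\<in>pauli_labels (Suc n). \<Prod>k<Suc n. f k (p k))
      = (\<Sum>(p, s)\<in>pauli_labels n \<times> {..<4}. (\<Prod>k<n. f k (p k)) * f n s)"
    unfolding pauli_labels_Suc by (subst sum.reindex[OF inj_on_upd_labels])
      (auto intro!: sum.cong simp: o_def)
  also have "\<dots> = (\<Sum>p\<in>pauli_labels n. \<Prod>k<n. f k (p k)) * (\<Sum>s<4. f n s)"
    by (simp add: sum_product sum.cartesian_product)
  finally show ?case by (simp add: Suc.IH)
qed

lemma prod_if_const:
  "finite A \<Longrightarrow> (\<Prod>k\<in>A. if P k then c else 0) = (if \<forall>k\<in>A. P k then c ^ card A else (0::'a::comm_semiring_1))"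
  by (induction A rule: finite_induct) auto

lemma lessThan_4: "{..<4::nat} = {0, 1, 2, 3}"
  by auto

lemma less_4_E:
  assumes "(a::nat) < 4"
  obtains "a = 0" | "a = 1" | "a = 2" | "a = 3"
  using assms by linarith

lemma less_2_E:
  assumes "(a::nat) < 2"
  obtains "a = 0" | "a = 1"
  using assms by linarith

lemma label_less_4: "p \<in> pauli_labels n \<Longrightarrow> p k < 4"
  by (cases "k < n") (auto simp: pauli_labels_def)

lemma label_eqI:
  assumes "p \<in> pauli_labels n" "q \<in> pauli_labels n" "\<And>k. k < n \<Longrightarrow> p k = q k"
  shows "p = q"
proof
  fix k show "p k = q k" using assms by (cases "k < n") (auto simp: pauli_labels_def)
qed

abbreviation zero_label :: "nat \<Rightarrow> nat" where "zero_label \<equiv> \<lambda>_. 0"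

lemma zero_label [simp]: "zero_label \<in> pauli_labels n"
  by (simp add: pauli_labels_def)

text \<open>Labels 1, 2, 3 are X, Y, Z; the product of two distinct ones is the third, with label \<open>6 - a - b\<close>.\<close>
definition mul1 :: "nat \<Rightarrow> nat \<Rightarrow> nat" where
  "mul1 a b = (if a = b then 0 else if a = 0 then b else if b = 0 then a else 6 - a - b)"

text \<open>Encodes \<open>XY = \<i> Z\<close> and its cyclic shifts; the reversed products carry
  the conjugate phase.\<close>

definition phase1 :: "nat \<Rightarrow> nat \<Rightarrow> complex" where
  "phase1 a b = (if a = 0 \<or> b = 0 \<or> a = b then 1
     else if (a, b) \<in> {(1, 2), (2, 3), (3, 1)} then \<i> else - \<i>)"

definition comm1 :: "nat \<Rightarrow> nat \<Rightarrow> real" where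
  "comm1 a b = (if a = 0 \<or> b = 0 \<or> a = b then 1 else -1)"

text \<open>On labels this is the Pauli group modulo phases, the group \<open>F_2^(2n)\<close>, in
  which every element is its own inverse.\<close>

definition lmul :: "(nat \<Rightarrow> nat) \<Rightarrow> (nat \<Rightarrow> nat) \<Rightarrow> nat \<Rightarrow> nat" where
  "lmul p q = (\<lambda>k. mul1 (p k) (q k))"

definition lphase :: "nat \<Rightarrow> (nat \<Rightarrow> nat) \<Rightarrow> (nat \<Rightarrow> nat) \<Rightarrow> complex" where
  "lphase n p q = (\<Prod>k<n. phase1 (p k) (q k))"

text \<open>This is -1 to the power of the symplectic form on \<open>F_2^(2n)\<close>, hence a
  character in each argument. It is real because it enters counts and inequalities.\<close>

definition lcomm :: "nat \<Rightarrow> (nat \<Rightarrow> nat) \<Rightarrow> (nat \<Rightarrow> nat) \<Rightarrow> real" where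
  "lcomm n p q = (\<Prod>k<n. comm1 (p k) (q k))"

lemma lmul_label [simp]:
  assumes "p \<in> pauli_labels n" "q \<in> pauli_labels n"
  shows "lmul p q \<in> pauli_labels n"
proof -
  have "mul1 (p k) (q k) < 4" for k
    using label_less_4[OF assms(1), of k] label_less_4[OF assms(2), of k]
    by (elim less_4_E) (simp_all add: mul1_def)
  then show ?thesis using assms by (auto simp: pauli_labels_def lmul_def mul1_def)
qed

lemma lmul_self [simp]: "lmul p p = zero_label"
  by (simp add: lmul_def mul1_def)

lemma lmul_eq_zero_iff:
  assumes "p \<in> pauli_labels n" "q \<in> pauli_labels n"
  shows "lmul p q = zero_label \<longleftrightarrow> p = q"
proof
  assume eq: "lmul p q = zero_label"
  show "p = q"
  proof
    fix k
    show "p k = q k"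
      using label_less_4[OF assms(1), of k] label_less_4[OF assms(2), of k] fun_cong[OF eq, of k]
      by (elim less_4_E) (simp_all add: mul1_def lmul_def)
  qed
qed simp

lemma lmul_lmul_cancel:
  assumes "p \<in> pauli_labels n" "q \<in> pauli_labels n"
  shows "lmul p (lmul p q) = q"
proof
  fix k
  show "lmul p (lmul p q) k = q k"
    using label_less_4[OF assms(1), of k] label_less_4[OF assms(2), of k]
    by (elim less_4_E) (simp_all add: mul1_def lmul_def)
qed

lemma lphase_values: "lphase n p q \<in> {1, -1, \<i>, -\<i>}"
proof -
  have "phase1 (p k) (q k) \<in> {1, -1, \<i>, -\<i>}" for k
    by (auto simp: phase1_def)
  then show ?thesis unfolding lphase_def
  proof (induction n)
    case (Suc n)
    then have "(\<Prod>k<n. phase1 (p k) (q k)) \<in> {1, -1, \<i>, -\<i>}" "phase1 (p n) (q n) \<in> {1, -1, \<i>, -\<i>}"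
      by auto
    then show ?case by auto
  qed simp
qed

lemma lcomm_values: "lcomm n p q = 1 \<or> lcomm n p q = -1"
  unfolding lcomm_def by (induction n) (auto simp: comm1_def)

lemma lcomm_commute: "lcomm n p q = lcomm n q p"
  unfolding lcomm_def comm1_def by (intro prod.cong) auto

lemma lcomm_self [simp]: "lcomm n p p = 1"
  by (simp add: lcomm_def comm1_def)

lemma lcomm_zero [simp]: "lcomm n p zero_label = 1" "lcomm n zero_label p = 1"
  by (simp_all add: lcomm_def comm1_def)

lemma lcomm_lmul:
  assumes "p \<in> pauli_labels n" "q \<in> pauli_labels n" "r \<in> pauli_labels n"
  shows "lcomm n r (lmul p q) = lcomm n r p * lcomm n r q"
proof -
  have "comm1 (r k) (lmul p q k) = comm1 (r k) (p k) * comm1 (r k) (q k)" for k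
    using label_less_4[OF assms(1), of k] label_less_4[OF assms(2), of k]
      label_less_4[OF assms(3), of k]
    by (elim less_4_E) (simp_all add: mul1_def lmul_def comm1_def)
  then show ?thesis by (simp add: lcomm_def prod.distrib)
qed

text \<open>A non-trivial character sums to zero over a group. On each qubit a non-identity Pauli
  commutes with two of the four and anticommutes with the other two, so its factor is 0, against 4
  for the identity.\<close>

lemma sum_lcomm:
  assumes "q \<in> pauli_labels n"
  shows "(\<Sum>p\<in>pauli_labels n. lcomm n p q) = (if q = zero_label then (2 ^ n)\<^sup>2 else 0)"
proof -
  have "(\<Sum>p\<in>pauli_labels n. lcomm n p q) = (\<Prod>k<n. \<Sum>s<4. comm1 s (q k))"
    unfolding lcomm_def by (rule sum_prod_labels)
  also have "\<dots> = (\<Prod>k<n. if q k = 0 then 4 else 0)"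
  proof (intro prod.cong refl)
    fix k
    show "(\<Sum>s<4. comm1 s (q k)) = (if q k = 0 then 4 else 0)"
      using label_less_4[OF assms, of k]
      by (elim less_4_E) (simp_all add: comm1_def lessThan_4)
  qed
  also have "\<dots> = (if q = zero_label then 4 ^ n else 0)"
  proof -
    have "(\<forall>k\<in>{..<n}. q k = 0) \<longleftrightarrow> q = zero_label"
      using label_eqI[OF assms zero_label] by blast
    then show ?thesis by (simp add: prod_if_const)
  qed
  also have "(4::real) ^ n = (2 ^ n)\<^sup>2" by (simp add: power2_eq_square flip: power_mult_distrib)
  finally show ?thesis .
qed

lemma lcomm_orthogonal:
  assumes "p \<in> pauli_labels n" "q \<in> pauli_labels n"
  shows "(\<Sum>r\<in>pauli_labels n. lcomm n r p * lcomm n r q) = (if p = q then (2 ^ n)\<^sup>2 else 0)"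
proof -
  have "(\<Sum>r\<in>pauli_labels n. lcomm n r p * lcomm n r q) = (\<Sum>r\<in>pauli_labels n. lcomm n r (lmul p q))"
    using assms by (intro sum.cong refl) (simp add: lcomm_lmul)
  then show ?thesis using assms by (simp add: sum_lcomm lmul_eq_zero_iff)
qed

lemma card_pauli_labels: "card (pauli_labels n) = (2 ^ n)\<^sup>2"
proof -
  \<comment> \<open>The trivial character sums to the number of labels.\<close>
  have "real (card (pauli_labels n)) = (2 ^ n)\<^sup>2"
    using sum_lcomm[of zero_label n] by simp
  then have "real (card (pauli_labels n)) = real ((2 ^ n)\<^sup>2)" by simp
  then show ?thesis by (rule of_nat_eq_iff[THEN iffD1])
qed

subsection \<open>Pauli matrices\<close>

lemma pauli_carrier [simp]: "pauli n p \<in> carrier_mat (2 ^ n) (2 ^ n)"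
  by (simp add: pauli_def)

lemma pauli_dim [simp]: "dim_row (pauli n p) = 2 ^ n" "dim_col (pauli n p) = 2 ^ n"
  by (simp_all add: pauli_def)

lemma pauli_index:
  "i < 2 ^ n \<Longrightarrow> j < 2 ^ n \<Longrightarrow> pauli n p $$ (i, j) = (\<Prod>k<n. sigma (p k) (qbit k i) (qbit k j))"
  by (simp add: pauli_def)

lemma mult_index:
  assumes "A \<in> carrier_mat m m" "B \<in> carrier_mat m m" "i < m" "j < m"
  shows "(A * B) $$ (i, j) = (\<Sum>l<m. A $$ (i, l) * B $$ (l, j))"
  using assms by (auto simp: scalar_prod_def atLeast0LessThan intro!: sum.cong)

lemma adj_carrier [simp]: "A \<in> carrier_mat m m \<Longrightarrow> adj A \<in> carrier_mat m m"
  by (rule carrier_matI) (auto simp: adj_def)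

lemma adj_dim [simp]: "dim_row (adj A) = dim_col A" "dim_col (adj A) = dim_row A"
  by (simp_all add: adj_def)

lemma adj_index: "A \<in> carrier_mat m m \<Longrightarrow> i < m \<Longrightarrow> j < m \<Longrightarrow> adj A $$ (i, j) = cnj (A $$ (j, i))"
  by (simp add: adj_def)

lemma pauli_zero_label: "pauli n zero_label = 1\<^sub>m (2 ^ n)"
proof (rule eq_matI)
  fix i j assume "i < dim_row (1\<^sub>m (2 ^ n) :: complex mat)" "j < dim_col (1\<^sub>m (2 ^ n) :: complex mat)"
  then have ij: "i < 2 ^ n" "j < 2 ^ n" by auto
  have "(\<forall>k\<in>{..<n}. qbit k i = qbit k j) \<longleftrightarrow> i = j"
    using qbit_eqI[OF ij] by blast
  then show "pauli n zero_label $$ (i, j) = 1\<^sub>m (2 ^ n) $$ (i, j)"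
    using ij by (simp add: pauli_index sigma_def prod_if_const)
qed auto

lemma adj_pauli: "adj (pauli n p) = pauli n p"
proof (rule eq_matI)
  fix i j assume "i < dim_row (pauli n p)" "j < dim_col (pauli n p)"
  then have ij: "i < 2 ^ n" "j < 2 ^ n" by auto
  have "cnj (sigma (p k) (qbit k j) (qbit k i)) = sigma (p k) (qbit k i) (qbit k j)" for k
    using qbit_less_2[of k i] qbit_less_2[of k j]
    by (elim less_2_E) (simp_all add: sigma_def)
  then show "adj (pauli n p) $$ (i, j) = pauli n p $$ (i, j)"
    using ij by (simp add: adj_index[OF pauli_carrier] pauli_index)
qed auto

lemma sigma_mult:
  assumes "a < 4" "b < 4" "x < 2" "y < 2"
  shows "sigma a x 0 * sigma b 0 y + sigma a x 1 * sigma b 1 y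
    = phase1 a b * sigma (mul1 a b) x y"
  using assms by (elim less_4_E less_2_E) (simp_all add: sigma_def phase1_def mul1_def)

lemma pauli_mult:
  assumes "p \<in> pauli_labels n" "q \<in> pauli_labels n"
  shows "pauli n p * pauli n q = lphase n p q \<cdot>\<^sub>m pauli n (lmul p q)"
proof (rule eq_matI)
  fix i j assume "i < dim_row (lphase n p q \<cdot>\<^sub>m pauli n (lmul p q))"
    "j < dim_col (lphase n p q \<cdot>\<^sub>m pauli n (lmul p q))"
  then have ij: "i < 2 ^ n" "j < 2 ^ n" by auto
  have "(pauli n p * pauli n q) $$ (i, j) = (\<Sum>l<2 ^ n. pauli n p $$ (i, l) * pauli n q $$ (l, j))"
    using ij by (intro mult_index) auto
  also have "\<dots> = (\<Sum>l<2 ^ n. \<Prod>k<n. sigma (p k) (qbit k i) (qbit k l) * sigma (q k) (qbit k l) (qbit k j))"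
    using ij by (intro sum.cong refl) (simp add: pauli_index prod.distrib)
  also have "\<dots> = (\<Prod>k<n. sigma (p k) (qbit k i) 0 * sigma (q k) 0 (qbit k j)
      + sigma (p k) (qbit k i) 1 * sigma (q k) 1 (qbit k j))"
    by (rule sum_prod_qbit[of "\<lambda>k a. sigma (p k) (qbit k i) a * sigma (q k) a (qbit k j)"])
  also have "\<dots> = (\<Prod>k<n. phase1 (p k) (q k) * sigma (lmul p q k) (qbit k i) (qbit k j))"
    using assms by (intro prod.cong refl) (simp only: sigma_mult label_less_4 qbit_less_2 lmul_def)
  finally show "(pauli n p * pauli n q) $$ (i, j) = (lphase n p q \<cdot>\<^sub>m pauli n (lmul p q)) $$ (i, j)"
    using ij by (simp add: pauli_index lphase_def prod.distrib)
qed auto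

lemma lmul_commute: "p \<in> pauli_labels n \<Longrightarrow> q \<in> pauli_labels n \<Longrightarrow> lmul p q = lmul q p"
  unfolding lmul_def mul1_def by (rule ext) auto

lemma lphase_commute:
  assumes "p \<in> pauli_labels n" "q \<in> pauli_labels n"
  shows "lphase n p q = complex_of_real (lcomm n p q) * lphase n q p"
proof -
  have "phase1 (p k) (q k) = complex_of_real (comm1 (p k) (q k)) * phase1 (q k) (p k)" for k
    using label_less_4[OF assms(1), of k] label_less_4[OF assms(2), of k]
    by (elim less_4_E) (simp_all add: phase1_def comm1_def)
  then show ?thesis by (simp add: lphase_def lcomm_def prod.distrib)
qed

lemma pauli_commute:
  assumes "p \<in> pauli_labels n" "q \<in> pauli_labels n"
  shows "pauli n p * pauli n q = complex_of_real (lcomm n p q) \<cdot>\<^sub>m (pauli n q * pauli n p)"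
  using assms
  by (simp add: pauli_mult lmul_commute[of p n q] lphase_commute[of p n q] mult_smult_assoc_mat)
     (auto intro!: eq_matI)

lemma pauli_square: "p \<in> pauli_labels n \<Longrightarrow> pauli n p * pauli n p = 1\<^sub>m (2 ^ n)"
  by (simp add: pauli_mult pauli_zero_label lphase_def phase1_def) (auto intro!: eq_matI)

lemma pauli_conj:
  assumes "p \<in> pauli_labels n" "q \<in> pauli_labels n"
  shows "pauli n p * pauli n q * pauli n p = complex_of_real (lcomm n p q) \<cdot>\<^sub>m pauli n q"
proof -
  have "pauli n p * pauli n q * pauli n p
      = (complex_of_real (lcomm n p q) \<cdot>\<^sub>m (pauli n q * pauli n p)) * pauli n p"
    using pauli_commute[OF assms] by simp
  also have "\<dots> = complex_of_real (lcomm n p q) \<cdot>\<^sub>m (pauli n q * pauli n p * pauli n p)"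
    by (rule mult_smult_assoc_mat[of _ "2^n" "2^n" _ "2^n"]) auto
  also have "pauli n q * pauli n p * pauli n p = pauli n q * (pauli n p * pauli n p)"
    by (rule assoc_mult_mat[of _ "2^n" "2^n" _ "2^n" _ "2^n"]) auto
  finally show ?thesis by (simp add: pauli_square assms(1))
qed

section \<open>Traces, and the Pauli strings as an orthogonal basis\<close>

lemma mtrace_mult:
  assumes "A \<in> carrier_mat m m" "B \<in> carrier_mat m m"
  shows "mtrace (A * B) = (\<Sum>i<m. \<Sum>j<m. A $$ (i, j) * B $$ (j, i))"
proof -
  have "mtrace (A * B) = (\<Sum>i<m. (A * B) $$ (i, i))"
    using assms by (auto simp: mtrace_def)
  also have "\<dots> = (\<Sum>i<m. \<Sum>j<m. A $$ (i, j) * B $$ (j, i))"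
    using assms by (intro sum.cong refl mult_index) auto
  finally show ?thesis .
qed

lemma mtrace_commute:
  assumes "A \<in> carrier_mat m m" "B \<in> carrier_mat m m"
  shows "mtrace (A * B) = mtrace (B * A)"
  unfolding mtrace_mult[OF assms] mtrace_mult[OF assms(2,1)]
  by (subst sum.swap) (simp add: mult.commute)

lemma mtrace_smult: "A \<in> carrier_mat m m \<Longrightarrow> mtrace (c \<cdot>\<^sub>m A) = c * mtrace A"
  by (simp add: mtrace_def sum_distrib_left)

lemma mtrace_pauli:
  assumes "p \<in> pauli_labels n"
  shows "mtrace (pauli n p) = (if p = zero_label then 2 ^ n else 0)"
proof -
  have "mtrace (pauli n p) = (\<Sum>i<2 ^ n. \<Prod>k<n. sigma (p k) (qbit k i) (qbit k i))"
    by (simp add: mtrace_def pauli_index)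
  also have "\<dots> = (\<Prod>k<n. sigma (p k) 0 0 + sigma (p k) 1 1)"
    by (rule sum_prod_qbit[of "\<lambda>k a. sigma (p k) a a"])
  also have "\<dots> = (\<Prod>k<n. if p k = 0 then 2 else 0)"
    by (intro prod.cong refl) (auto simp: sigma_def)
  also have "\<dots> = (if p = zero_label then 2 ^ n else 0)"
  proof -
    have "(\<forall>k\<in>{..<n}. p k = 0) \<longleftrightarrow> p = zero_label"
      using label_eqI[OF assms zero_label] by blast
    then show ?thesis by (simp add: prod_if_const)
  qed
  finally show ?thesis .
qed

text \<open>Distinct strings are orthogonal for the trace form. This makes the label of a conjugated
  Pauli unique, so that \<open>act\<close> below is well defined.\<close>

lemma pauli_proportional:
  assumes "p \<in> pauli_labels n" "q \<in> pauli_labels n" "c \<noteq> 0"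
    and eq: "c \<cdot>\<^sub>m pauli n p = c' \<cdot>\<^sub>m pauli n q"
  shows "p = q"
proof (rule ccontr)
  assume "p \<noteq> q"
  have *: "mtrace ((a \<cdot>\<^sub>m pauli n r) * pauli n p) = (if r = p then a * 2 ^ n else 0)"
    if "r \<in> pauli_labels n" for a r
  proof -
    have "(a \<cdot>\<^sub>m pauli n r) * pauli n p = a \<cdot>\<^sub>m (pauli n r * pauli n p)"
      by (rule mult_smult_assoc_mat[of _ "2^n" "2^n" _ "2^n"]) auto
    then show ?thesis using that assms(1)
      by (simp add: pauli_mult mtrace_smult[of _ "2^n"] mtrace_pauli lmul_eq_zero_iff)
        (simp add: lphase_def phase1_def)
  qed
  from *[OF assms(1), of c] *[OF assms(2), of c'] eq \<open>p \<noteq> q\<close> \<open>c \<noteq> 0\<close> show False by auto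
qed

lemma sigma_complete:
  assumes "a < 2" "b < 2" "a' < 2" "b' < 2"
  shows "(\<Sum>s<4. sigma s a b * sigma s a' b') = (if a = b' \<and> b = a' then 2 else 0)"
  using assms by (elim less_2_E) (simp_all add: sigma_def lessThan_4)

text \<open>The sum of \<open>P\<close> tensor \<open>P\<close> over all strings is
  \<open>2 ^ n\<close> times the swap operator, qubit by qubit. It yields Pauli expansions by direct
  computation, without a dimension argument.\<close>

lemma pauli_complete:
  assumes "i < 2 ^ n" "j < 2 ^ n" "k < 2 ^ n" "l < 2 ^ n"
  shows "(\<Sum>p\<in>pauli_labels n. pauli n p $$ (i, j) * pauli n p $$ (k, l))
    = (if i = l \<and> j = k then 2 ^ n else 0)"
proof -
  have "(\<Sum>p\<in>pauli_labels n. pauli n p $$ (i, j) * pauli n p $$ (k, l))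
    = (\<Sum>p\<in>pauli_labels n. \<Prod>m<n. sigma (p m) (qbit m i) (qbit m j) * sigma (p m) (qbit m k) (qbit m l))"
    using assms by (simp add: pauli_index prod.distrib)
  also have "\<dots> = (\<Prod>m<n. \<Sum>s<4. sigma s (qbit m i) (qbit m j) * sigma s (qbit m k) (qbit m l))"
    by (rule sum_prod_labels[of "\<lambda>m s. sigma s (qbit m i) (qbit m j) * sigma s (qbit m k) (qbit m l)"])
  also have "\<dots> = (\<Prod>m<n. if qbit m i = qbit m l \<and> qbit m j = qbit m k then 2 else 0)"
    by (intro prod.cong refl sigma_complete qbit_less_2)
  also have "\<dots> = (if i = l \<and> j = k then 2 ^ n else 0)"
  proof -
    have "(\<forall>m\<in>{..<n}. qbit m i = qbit m l \<and> qbit m j = qbit m k) \<longleftrightarrow> i = l \<and> j = k"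
      using qbit_eqI[of i n l] qbit_eqI[of j n k] assms by blast
    then show ?thesis by (simp add: prod_if_const)
  qed
  finally show ?thesis .
qed

section \<open>Diagonal Pauli strings and Pauli expansions\<close>

definition ztype :: "nat \<Rightarrow> (nat \<Rightarrow> nat) set" where
  "ztype n = {p \<in> pauli_labels n. \<forall>k<n. p k = 0 \<or> p k = 3}"

lemma card_ztype: "card (ztype n) = 2 ^ n"
proof -
  have "card (ztype n) = (\<Sum>p\<in>pauli_labels n. if \<forall>k\<in>{..<n}. p k = 0 \<or> p k = 3 then 1 else 0)"
    unfolding ztype_def card_eq_sum by (subst sum.inter_filter) (simp_all add: lessThan_def)
  also have "\<dots> = (\<Sum>p\<in>pauli_labels n. \<Prod>k<n. if p k = 0 \<or> p k = 3 then 1 else 0)"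
    by (simp add: prod_if_const cong: if_cong)
  also have "\<dots> = (\<Prod>k<n. \<Sum>s<4::nat. if s = 0 \<or> s = 3 then 1 else 0)"
    by (rule sum_prod_labels)
  finally show ?thesis by (simp add: lessThan_4 numeral_2_eq_2)
qed

text \<open>A string containing \<open>X\<close> or \<open>Y\<close> has zero diagonal, and the
  diagonals of the strings over \<open>I, Z\<close> are the characters of \<open>F_2^n\<close>,
  which are orthogonal.\<close>

lemma sum_diag_pauli:
  assumes "p \<in> pauli_labels n" "q \<in> pauli_labels n"
  shows "(\<Sum>b<2 ^ n. pauli n p $$ (b, b) * pauli n q $$ (b, b))
    = (if p = q \<and> p \<in> ztype n then 2 ^ n else 0)"
proof -
  have "(\<Sum>b<2 ^ n. pauli n p $$ (b, b) * pauli n q $$ (b, b))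
    = (\<Sum>b<2 ^ n. \<Prod>k<n. sigma (p k) (qbit k b) (qbit k b) * sigma (q k) (qbit k b) (qbit k b))"
    by (simp add: pauli_index prod.distrib)
  also have "\<dots> = (\<Prod>k<n. sigma (p k) 0 0 * sigma (q k) 0 0 + sigma (p k) 1 1 * sigma (q k) 1 1)"
    by (rule sum_prod_qbit[of "\<lambda>k a. sigma (p k) a a * sigma (q k) a a"])
  also have "\<dots> = (\<Prod>k<n. if p k = q k \<and> (p k = 0 \<or> p k = 3) then 2 else 0)"
  proof (intro prod.cong refl)
    fix k
    show "sigma (p k) 0 0 * sigma (q k) 0 0 + sigma (p k) 1 1 * sigma (q k) 1 1
      = (if p k = q k \<and> (p k = 0 \<or> p k = 3) then 2 else 0)"
      using label_less_4[OF assms(1), of k] label_less_4[OF assms(2), of k]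
      by (elim less_4_E) (simp_all add: sigma_def)
  qed
  also have "\<dots> = (if p = q \<and> p \<in> ztype n then 2 ^ n else 0)"
  proof -
    have "(\<forall>k\<in>{..<n}. p k = q k \<and> (p k = 0 \<or> p k = 3)) \<longleftrightarrow> p = q \<and> p \<in> ztype n"
      using label_eqI[OF assms] assms by (auto simp: ztype_def)
    then show ?thesis by (auto simp: prod_if_const)
  qed
  finally show ?thesis .
qed

lemma lcomm_ztype:
  assumes "p \<in> ztype n" "q \<in> ztype n"
  shows "lcomm n p q = 1"
proof -
  have "comm1 (p k) (q k) = 1" if "k < n" for k
  proof -
    have "p k = 0 \<or> p k = 3" "q k = 0 \<or> q k = 3"
      using assms that by (auto simp: ztype_def)
    then show ?thesis by (auto simp: comm1_def)
  qed
  then show ?thesis by (simp add: lcomm_def)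
qed

lemma zero_ztype: "zero_label \<in> ztype n"
  by (simp add: ztype_def)

lemma pauli_expansion:
  assumes A: "A \<in> carrier_mat (2 ^ n) (2 ^ n)" and ij: "i < 2 ^ n" "j < 2 ^ n"
  shows "(\<Sum>p\<in>pauli_labels n. mtrace (A * pauli n p) * pauli n p $$ (i, j)) = 2 ^ n * A $$ (i, j)"
proof -
  have "(\<Sum>p\<in>pauli_labels n. mtrace (A * pauli n p) * pauli n p $$ (i, j))
    = (\<Sum>p\<in>pauli_labels n. \<Sum>k<2 ^ n. \<Sum>l<2 ^ n. A $$ (k, l) * (pauli n p $$ (l, k) * pauli n p $$ (i, j)))"
    by (simp add: mtrace_mult[OF A pauli_carrier] sum_distrib_right mult.assoc)
  also have "\<dots> = (\<Sum>k<2 ^ n. \<Sum>l<2 ^ n. \<Sum>p\<in>pauli_labels n. A $$ (k, l) * (pauli n p $$ (l, k) * pauli n p $$ (i, j)))"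
    by (subst sum.swap, rule sum.cong[OF refl], rule sum.swap)
  also have "\<dots> = (\<Sum>k<2 ^ n. \<Sum>l<2 ^ n. if l = j then (if k = i then A $$ (k, l) * 2 ^ n else 0) else 0)"
    using ij by (intro sum.cong refl) (simp add: pauli_complete flip: sum_distrib_left)
  also have "\<dots> = 2 ^ n * A $$ (i, j)"
    using ij by (simp add: mult.commute)
  finally show ?thesis .
qed

text \<open>Parseval's identity in the Pauli basis. It serves twice in the end: for the sum of
  \<open>Xi2\<close>, and for the Hilbert-Schmidt norm of \<open>Obs\<close>.\<close>

lemma sum_mtrace_pauli:
  assumes A: "A \<in> carrier_mat (2 ^ n) (2 ^ n)" and B: "B \<in> carrier_mat (2 ^ n) (2 ^ n)"
  shows "(\<Sum>p\<in>pauli_labels n. mtrace (A * pauli n p) * mtrace (B * pauli n p)) = 2 ^ n * mtrace (A * B)"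
proof -
  have "(\<Sum>p\<in>pauli_labels n. mtrace (A * pauli n p) * mtrace (B * pauli n p))
    = (\<Sum>p\<in>pauli_labels n. \<Sum>k<2 ^ n. \<Sum>l<2 ^ n. B $$ (k, l) * (mtrace (A * pauli n p) * pauli n p $$ (l, k)))"
    by (simp add: mtrace_mult[OF B pauli_carrier] sum_distrib_left ac_simps)
  also have "\<dots> = (\<Sum>k<2 ^ n. \<Sum>l<2 ^ n. \<Sum>p\<in>pauli_labels n. B $$ (k, l) * (mtrace (A * pauli n p) * pauli n p $$ (l, k)))"
    by (subst sum.swap, rule sum.cong[OF refl], rule sum.swap)
  also have "\<dots> = (\<Sum>k<2 ^ n. \<Sum>l<2 ^ n. B $$ (k, l) * (2 ^ n * A $$ (l, k)))"
    by (intro sum.cong refl) (simp add: pauli_expansion[OF A] flip: sum_distrib_left)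
  also have "\<dots> = 2 ^ n * mtrace (B * A)"
    by (simp add: mtrace_mult[OF B A] sum_distrib_left ac_simps)
  finally show ?thesis by (simp add: mtrace_commute[OF A B])
qed

subsection \<open>The Clifford action on labels\<close>

lemma unitaryD:
  assumes "unitary m U"
  shows "U \<in> carrier_mat m m" "adj U * U = 1\<^sub>m m" "U * adj U = 1\<^sub>m m"
  using assms by (auto simp: unitary_def)

lemma square_mult_carrier [simp]:
  "A \<in> carrier_mat m m \<Longrightarrow> B \<in> carrier_mat m m \<Longrightarrow> A * B \<in> carrier_mat m m"
  by (rule mult_carrier_mat)

lemma adj_mult:
  assumes "A \<in> carrier_mat m m" "B \<in> carrier_mat m m"
  shows "adj (A * B) = adj B * adj A"
proof (rule eq_matI)
  fix i j assume "i < dim_row (adj B * adj A)" "j < dim_col (adj B * adj A)"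
  then have ij: "i < m" "j < m" using assms by auto
  have "adj (A * B) $$ (i, j) = cnj (\<Sum>l<m. A $$ (j, l) * B $$ (l, i))"
    using ij assms by (simp only: adj_index[OF mult_carrier_mat[OF assms]] mult_index)
  also have "\<dots> = (\<Sum>l<m. adj B $$ (i, l) * adj A $$ (l, j))"
    using ij assms by (simp add: adj_index[of _ m] mult.commute)
  also have "\<dots> = (adj B * adj A) $$ (i, j)"
    using ij assms by (intro mult_index[symmetric]) auto
  finally show "adj (A * B) $$ (i, j) = (adj B * adj A) $$ (i, j)" .
qed (use assms in auto)

lemma adj_smult: "adj (c \<cdot>\<^sub>m A) = cnj c \<cdot>\<^sub>m adj A"
  by (rule eq_matI) (auto simp: adj_def)

lemma adj_one: "adj (1\<^sub>m m) = 1\<^sub>m m"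
  by (rule eq_matI) (auto simp: adj_def)

lemma smult_smult_mat: "a \<cdot>\<^sub>m (b \<cdot>\<^sub>m A) = (a * b) \<cdot>\<^sub>m (A :: complex mat)"
  by (rule eq_matI) auto

lemma one_smult_mat: "1 \<cdot>\<^sub>m A = (A :: complex mat)"
  by (rule eq_matI) auto

definition conj_by :: "complex mat \<Rightarrow> complex mat \<Rightarrow> complex mat" where
  "conj_by U A = U * A * adj U"

lemma conj_by_carrier [simp]:
  "U \<in> carrier_mat m m \<Longrightarrow> A \<in> carrier_mat m m \<Longrightarrow> conj_by U A \<in> carrier_mat m m"
  unfolding conj_by_def
  by (rule mult_carrier_mat[of _ m m], rule mult_carrier_mat[of _ m m]) simp_all

lemma conj_by_mult:
  assumes U: "unitary m U" and A: "A \<in> carrier_mat m m" and B: "B \<in> carrier_mat m m"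
  shows "conj_by U A * conj_by U B = conj_by U (A * B)"
proof -
  note U' = unitaryD[OF U] adj_carrier[OF unitaryD(1)[OF U]]
  have "conj_by U A * conj_by U B = U * A * (adj U * (U * (B * adj U)))"
    unfolding conj_by_def using U' A B by (simp add: assoc_mult_mat[of _ m m _ m _ m])
  also have "adj U * (U * (B * adj U)) = (adj U * U) * (B * adj U)"
    using U'(1,4) A B by (simp add: assoc_mult_mat[of _ m m _ m _ m])
  also have "\<dots> = B * adj U"
    using U' B by (simp add: left_mult_one_mat[of _ m m])
  also have "U * A * (B * adj U) = conj_by U (A * B)"
    unfolding conj_by_def using U' A B by (simp add: assoc_mult_mat[of _ m m _ m _ m])
  finally show ?thesis .
qed

lemma conj_by_smult:
  assumes "U \<in> carrier_mat m m" "A \<in> carrier_mat m m"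
  shows "conj_by U (c \<cdot>\<^sub>m A) = c \<cdot>\<^sub>m conj_by U A"
  unfolding conj_by_def using assms adj_carrier[OF assms(1)]
  by (simp add: mult_smult_distrib[of _ m m _ m] mult_smult_assoc_mat[of _ m m _ m])

lemma conj_by_comp:
  assumes "U \<in> carrier_mat m m" "V \<in> carrier_mat m m" "A \<in> carrier_mat m m"
  shows "conj_by (U * V) A = conj_by U (conj_by V A)"
  unfolding conj_by_def using assms adj_carrier[OF assms(1)] adj_carrier[OF assms(2)]
  by (simp add: assoc_mult_mat[of _ m m _ m _ m] adj_mult[of _ m])

lemma conj_by_one:
  assumes "unitary m U"
  shows "conj_by U (1\<^sub>m m) = 1\<^sub>m m"
  using unitaryD[OF assms] by (simp add: conj_by_def)

lemma conj_by_adj_cancel: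
  assumes "unitary m U" "A \<in> carrier_mat m m"
  shows "conj_by (adj U) (conj_by U A) = A"
proof -
  note U = unitaryD[OF assms(1)]
  have "conj_by (adj U) (conj_by U A) = conj_by (adj U * U) A"
    using U(1) assms by (simp add: conj_by_comp[of _ m])
  then show ?thesis using U assms(2)
    by (simp add: conj_by_def adj_one)
qed

lemma unitary_mult:
  assumes "unitary m U" "unitary m V"
  shows "unitary m (U * V)"
proof -
  note U = unitaryD[OF assms(1)] adj_carrier[OF unitaryD(1)[OF assms(1)]]
  note V = unitaryD[OF assms(2)] adj_carrier[OF unitaryD(1)[OF assms(2)]]
  have "adj (U * V) * (U * V) = adj V * ((adj U * U) * V)"
    using U(1,4) V(1,4) by (simp add: assoc_mult_mat[of _ m m _ m _ m] adj_mult[of _ m])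
  also have "\<dots> = 1\<^sub>m m" using U V by simp
  finally have *: "adj (U * V) * (U * V) = 1\<^sub>m m" .
  have "(U * V) * adj (U * V) = U * ((V * adj V) * adj U)"
    using U(1,4) V(1,4) by (simp add: assoc_mult_mat[of _ m m _ m _ m] adj_mult[of _ m])
  also have "\<dots> = 1\<^sub>m m" using U V by simp
  finally show ?thesis using * U V by (auto simp: unitary_def)
qed

lemma conj_by_index:
  assumes "U \<in> carrier_mat m m" "A \<in> carrier_mat m m" "a < m" "b < m"
  shows "conj_by U A $$ (a, b) = (\<Sum>i<m. \<Sum>j<m. U $$ (a, i) * A $$ (i, j) * cnj (U $$ (b, j)))"
proof -
  have "conj_by U A $$ (a, b) = (\<Sum>j<m. (U * A) $$ (a, j) * adj U $$ (j, b))"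
    unfolding conj_by_def using assms by (intro mult_index) auto
  also have "\<dots> = (\<Sum>j<m. \<Sum>i<m. U $$ (a, i) * A $$ (i, j) * cnj (U $$ (b, j)))"
  proof (intro sum.cong refl)
    fix j assume "j \<in> {..<m}"
    then have j: "j < m" by simp
    have "(U * A) $$ (a, j) = (\<Sum>i<m. U $$ (a, i) * A $$ (i, j))"
      using assms j by (intro mult_index) auto
    moreover have "adj U $$ (j, b) = cnj (U $$ (b, j))"
      using assms j by (intro adj_index) auto
    ultimately show "(U * A) $$ (a, j) * adj U $$ (j, b) = (\<Sum>i<m. U $$ (a, i) * A $$ (i, j) * cnj (U $$ (b, j)))"
      by (simp add: sum_distrib_right)
  qed
  finally show ?thesis by (subst sum.swap)
qed

lemma conj_by_expansion:
  assumes "U \<in> carrier_mat (2 ^ n) (2 ^ n)" "A \<in> carrier_mat (2 ^ n) (2 ^ n)" "a < 2 ^ n" "b < 2 ^ n"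
  shows "(\<Sum>p\<in>pauli_labels n. mtrace (A * pauli n p) * conj_by U (pauli n p) $$ (a, b))
    = 2 ^ n * conj_by U A $$ (a, b)"
proof -
  have "(\<Sum>p\<in>pauli_labels n. mtrace (A * pauli n p) * conj_by U (pauli n p) $$ (a, b))
    = (\<Sum>p\<in>pauli_labels n. \<Sum>i<2 ^ n. \<Sum>j<2 ^ n.
        U $$ (a, i) * cnj (U $$ (b, j)) * (mtrace (A * pauli n p) * pauli n p $$ (i, j)))"
    using assms by (simp add: conj_by_index[of _ "2 ^ n"] sum_distrib_left ac_simps)
  also have "\<dots> = (\<Sum>i<2 ^ n. \<Sum>j<2 ^ n. \<Sum>p\<in>pauli_labels n.
        U $$ (a, i) * cnj (U $$ (b, j)) * (mtrace (A * pauli n p) * pauli n p $$ (i, j)))"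
    by (subst sum.swap, rule sum.cong[OF refl], rule sum.swap)
  also have "\<dots> = (\<Sum>i<2 ^ n. \<Sum>j<2 ^ n. U $$ (a, i) * cnj (U $$ (b, j)) * (2 ^ n * A $$ (i, j)))"
    using assms by (intro sum.cong refl) (simp add: pauli_expansion flip: sum_distrib_left)
  also have "\<dots> = 2 ^ n * conj_by U A $$ (a, b)"
    using assms by (simp add: conj_by_index[of _ "2 ^ n"] sum_distrib_left ac_simps)
  finally show ?thesis .
qed

text \<open>The matrix unit \<open>|k><l|\<close>. Conjugating it exposes products of an entry of
  \<open>U\<close> with a conjugated entry, both for recovering \<open>U\<close> up to a phase and
  for writing the entries of \<open>adj U |b><b| U\<close> as diagonal entries of a
  conjugate.\<close>

definition munit :: "nat \<Rightarrow> nat \<Rightarrow> nat \<Rightarrow> complex mat" where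
  "munit m k l = mat m m (\<lambda>(i, j). if i = k \<and> j = l then 1 else 0)"

lemma munit_carrier [simp]: "munit m k l \<in> carrier_mat m m"
  by (simp add: munit_def)

lemma conj_by_munit:
  assumes "U \<in> carrier_mat m m" "k < m" "l < m" "a < m" "b < m"
  shows "conj_by U (munit m k l) $$ (a, b) = U $$ (a, k) * cnj (U $$ (b, l))"
proof -
  have "conj_by U (munit m k l) $$ (a, b)
      = (\<Sum>i<m. \<Sum>j<m. if j = l then (if i = k then U $$ (a, i) * cnj (U $$ (b, j)) else 0) else 0)"
    unfolding conj_by_index[OF assms(1) munit_carrier assms(4,5)]
    by (intro sum.cong refl) (auto simp: munit_def)
  then show ?thesis using assms by simp
qed

lemma mtrace_munit:
  assumes "A \<in> carrier_mat m m" "k < m" "l < m"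
  shows "mtrace (munit m k l * A) = A $$ (l, k)"
proof -
  have "mtrace (munit m k l * A) = (\<Sum>i<m. \<Sum>j<m. if j = l then (if i = k then A $$ (j, i) else 0) else 0)"
    unfolding mtrace_mult[OF munit_carrier assms(1)]
    by (intro sum.cong refl) (auto simp: munit_def)
  then show ?thesis using assms by simp
qed

section \<open>The permutation of Pauli labels induced by a Clifford unitary\<close>

definition act :: "nat \<Rightarrow> complex mat \<Rightarrow> (nat \<Rightarrow> nat) \<Rightarrow> nat \<Rightarrow> nat" where
  "act n U p = (THE q. q \<in> pauli_labels n \<and> (\<exists>c. c \<noteq> 0 \<and> conj_by U (pauli n p) = c \<cdot>\<^sub>m pauli n q))"

lemma act_eqI:
  assumes "q \<in> pauli_labels n" "c \<noteq> 0" "conj_by U (pauli n p) = c \<cdot>\<^sub>m pauli n q"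
  shows "act n U p = q"
  unfolding act_def
proof (rule the_equality)
  show "q \<in> pauli_labels n \<and> (\<exists>c. c \<noteq> 0 \<and> conj_by U (pauli n p) = c \<cdot>\<^sub>m pauli n q)"
    using assms by blast
  fix r assume "r \<in> pauli_labels n \<and> (\<exists>c. c \<noteq> 0 \<and> conj_by U (pauli n p) = c \<cdot>\<^sub>m pauli n r)"
  then show "r = q"
    using assms pauli_proportional by metis
qed

lemma cliffordD: "U \<in> clifford n \<Longrightarrow> unitary (2 ^ n) U" "U \<in> clifford n \<Longrightarrow> U \<in> carrier_mat (2 ^ n) (2 ^ n)"
  by (auto simp: clifford_def unitary_def)

lemma pauli_smult_cancel:
  assumes "a \<cdot>\<^sub>m pauli n p = b \<cdot>\<^sub>m pauli n p" "p \<in> pauli_labels n"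
  shows "a = b"
proof -
  have *: "mtrace ((c \<cdot>\<^sub>m pauli n p) * pauli n p) = c * 2 ^ n" for c
  proof -
    have "(c \<cdot>\<^sub>m pauli n p) * pauli n p = c \<cdot>\<^sub>m (pauli n p * pauli n p)"
      by (rule mult_smult_assoc_mat[of _ "2^n" "2^n" _ "2^n"]) auto
    then show ?thesis using assms(2) mtrace_pauli[OF zero_label, of n]
      by (simp add: pauli_square mtrace_smult[of _ "2^n"] pauli_zero_label)
  qed
  have "a * 2 ^ n = b * 2 ^ n"
    by (metis * assms(1))
  then show ?thesis by simp
qed

text \<open>The definition of \<open>clifford\<close> also admits the phases \<open>\<i>\<close> and
  \<open>-\<i>\<close>. They cannot occur: conjugation preserves squares and every Pauli squares to
  the identity, so the phase does too.\<close>

lemma clifford_act: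
  assumes "U \<in> clifford n" "p \<in> pauli_labels n"
  obtains c where "c\<^sup>2 = 1" "act n U p \<in> pauli_labels n"
    "conj_by U (pauli n p) = c \<cdot>\<^sub>m pauli n (act n U p)"
proof -
  obtain c q where c: "c \<in> {1, -1, \<i>, -\<i>}" and q: "q \<in> pauli_labels n"
    and eq: "conj_by U (pauli n p) = c \<cdot>\<^sub>m pauli n q"
    using assms unfolding clifford_def conj_by_def by blast
  have "c \<noteq> 0" using c by auto
  have act: "act n U p = q" by (rule act_eqI[OF q \<open>c \<noteq> 0\<close> eq])
  have "conj_by U (pauli n p) * conj_by U (pauli n p) = 1\<^sub>m (2 ^ n)"
    using assms cliffordD[OF assms(1)]
    by (simp add: conj_by_mult[of "2 ^ n"] pauli_square conj_by_one)
  also have "conj_by U (pauli n p) * conj_by U (pauli n p) = (c * c) \<cdot>\<^sub>m (pauli n q * pauli n q)"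
    unfolding eq by (simp add: mult_smult_distrib[of _ "2 ^ n" "2 ^ n" _ "2 ^ n"]
        mult_smult_assoc_mat[of _ "2 ^ n" "2 ^ n" _ "2 ^ n"] smult_smult_mat)
  finally have "(c * c) \<cdot>\<^sub>m pauli n zero_label = 1 \<cdot>\<^sub>m pauli n zero_label"
    using q by (simp add: pauli_square pauli_zero_label one_smult_mat)
  from pauli_smult_cancel[OF this] have "c\<^sup>2 = 1" by (simp add: power2_eq_square)
  then show ?thesis using that act q eq by blast
qed

lemma act_label: "U \<in> clifford n \<Longrightarrow> p \<in> pauli_labels n \<Longrightarrow> act n U p \<in> pauli_labels n"
  by (rule clifford_act)

lemma act_zero: "U \<in> clifford n \<Longrightarrow> act n U zero_label = zero_label"
  by (rule act_eqI[where c = 1])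
    (simp_all add: pauli_zero_label conj_by_one cliffordD one_smult_mat)

lemma act_inj:
  assumes U: "U \<in> clifford n" and p: "p \<in> pauli_labels n" and q: "q \<in> pauli_labels n"
    and eq: "act n U p = act n U q"
  shows "p = q"
proof -
  obtain c where c: "c\<^sup>2 = 1" "conj_by U (pauli n p) = c \<cdot>\<^sub>m pauli n (act n U p)"
    using clifford_act[OF U p] by metis
  obtain c' where c': "c'\<^sup>2 = 1" "conj_by U (pauli n q) = c' \<cdot>\<^sub>m pauli n (act n U q)"
    using clifford_act[OF U q] by metis
  have "conj_by U (c' \<cdot>\<^sub>m pauli n p) = conj_by U (c \<cdot>\<^sub>m pauli n q)"
    using cliffordD[OF U] c c' eq
    by (simp add: conj_by_smult[of _ "2 ^ n"] smult_smult_mat mult.commute)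
  then have "c' \<cdot>\<^sub>m pauli n p = c \<cdot>\<^sub>m pauli n q"
    using conj_by_adj_cancel[OF cliffordD(1)[OF U]] by (metis pauli_carrier smult_carrier_mat)
  moreover have "c' \<noteq> 0" using c' by auto
  ultimately show ?thesis using pauli_proportional[OF p q] by blast
qed

text \<open>Conjugate \<open>P Q P = \<plusminus> Q\<close>. The sign of the image of
  \<open>P\<close> enters squared and that of \<open>Q\<close> occurs on both sides, so the
  commutation sign is preserved.\<close>

lemma act_lcomm:
  assumes U: "U \<in> clifford n" and p: "p \<in> pauli_labels n" and q: "q \<in> pauli_labels n"
  shows "lcomm n (act n U p) (act n U q) = lcomm n p q"
proof -
  note U' = cliffordD[OF U]
  obtain c where c: "c\<^sup>2 = 1" "act n U p \<in> pauli_labels n" "conj_by U (pauli n p) = c \<cdot>\<^sub>m pauli n (act n U p)"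
    using clifford_act[OF U p] by metis
  obtain c' where c': "c'\<^sup>2 = 1" "act n U q \<in> pauli_labels n" "conj_by U (pauli n q) = c' \<cdot>\<^sub>m pauli n (act n U q)"
    using clifford_act[OF U q] by metis
  have "conj_by U (pauli n p) * conj_by U (pauli n q) * conj_by U (pauli n p)
    = conj_by U (pauli n p * pauli n q * pauli n p)"
    using U' by (simp add: conj_by_mult[of "2 ^ n"])
  also have "\<dots> = (complex_of_real (lcomm n p q) * c') \<cdot>\<^sub>m pauli n (act n U q)"
    using U' p q by (simp add: pauli_conj conj_by_smult[of _ "2 ^ n"] c' smult_smult_mat)
  also have "conj_by U (pauli n p) * conj_by U (pauli n q) * conj_by U (pauli n p)
    = (c\<^sup>2 * c') \<cdot>\<^sub>m (pauli n (act n U p) * pauli n (act n U q) * pauli n (act n U p))"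
    unfolding c(3) c'(3) by (simp add: mult_smult_distrib[of _ "2 ^ n" "2 ^ n" _ "2 ^ n"]
        mult_smult_assoc_mat[of _ "2 ^ n" "2 ^ n" _ "2 ^ n"] smult_smult_mat power2_eq_square ac_simps)
  also have "\<dots> = (c' * complex_of_real (lcomm n (act n U p) (act n U q))) \<cdot>\<^sub>m pauli n (act n U q)"
    using c c' by (simp add: pauli_conj smult_smult_mat)
  finally have "c' * complex_of_real (lcomm n (act n U p) (act n U q)) = complex_of_real (lcomm n p q) * c'"
    using pauli_smult_cancel c'(2) by blast
  moreover have "c' \<noteq> 0" using c' by auto
  ultimately show ?thesis by simp
qed

lemma clifford_mult:
  assumes U: "U \<in> clifford n" and V: "V \<in> clifford n"
  shows "U * V \<in> clifford n"
proof -
  have "\<exists>c q. c \<in> {1, -1, \<i>, -\<i>} \<and> q \<in> pauli_labels n \<and> conj_by (U * V) (pauli n p) = c \<cdot>\<^sub>m pauli n q"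
    if p: "p \<in> pauli_labels n" for p
  proof -
    obtain c where c: "c\<^sup>2 = 1" "act n V p \<in> pauli_labels n" "conj_by V (pauli n p) = c \<cdot>\<^sub>m pauli n (act n V p)"
      using clifford_act[OF V p] by metis
    obtain c' where c': "c'\<^sup>2 = 1" "act n U (act n V p) \<in> pauli_labels n"
      "conj_by U (pauli n (act n V p)) = c' \<cdot>\<^sub>m pauli n (act n U (act n V p))"
      using clifford_act[OF U c(2)] by metis
    have "conj_by (U * V) (pauli n p) = (c * c') \<cdot>\<^sub>m pauli n (act n U (act n V p))"
      using cliffordD[OF U] cliffordD[OF V]
      by (simp add: conj_by_comp[of _ "2 ^ n"] c c' conj_by_smult[of _ "2 ^ n"] smult_smult_mat)
    moreover have "(c * c')\<^sup>2 = 1" using c c' by (simp add: power_mult_distrib)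
    then have "c * c' = 1 \<or> c * c' = -1" by (simp add: power2_eq_1_iff)
    ultimately show ?thesis using c'(2) by blast
  qed
  then show ?thesis
    using unitary_mult[OF cliffordD(1)[OF U] cliffordD(1)[OF V]]
    unfolding clifford_def conj_by_def by blast
qed

lemma act_mult:
  assumes U: "U \<in> clifford n" and V: "V \<in> clifford n" and p: "p \<in> pauli_labels n"
  shows "act n (U * V) p = act n U (act n V p)"
proof -
  obtain c where c: "c\<^sup>2 = 1" "act n V p \<in> pauli_labels n" "conj_by V (pauli n p) = c \<cdot>\<^sub>m pauli n (act n V p)"
    using clifford_act[OF V p] by metis
  obtain c' where c': "c'\<^sup>2 = 1" "act n U (act n V p) \<in> pauli_labels n"
    "conj_by U (pauli n (act n V p)) = c' \<cdot>\<^sub>m pauli n (act n U (act n V p))"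
    using clifford_act[OF U c(2)] by metis
  have "conj_by (U * V) (pauli n p) = (c * c') \<cdot>\<^sub>m pauli n (act n U (act n V p))"
    using cliffordD[OF U] cliffordD[OF V]
    by (simp add: conj_by_comp[of _ "2 ^ n"] c c' conj_by_smult[of _ "2 ^ n"] smult_smult_mat)
  moreover have "c * c' \<noteq> 0" using c c' by auto
  ultimately show ?thesis using c' by (intro act_eqI)
qed

lemma one_clifford: "1\<^sub>m (2 ^ n) \<in> clifford n"
proof -
  have "1\<^sub>m (2 ^ n) * pauli n p * adj (1\<^sub>m (2 ^ n)) = 1 \<cdot>\<^sub>m pauli n p" for p
    by (simp add: adj_one one_smult_mat)
  then show ?thesis unfolding clifford_def unitary_def
    by (auto simp: adj_one simp del: left_mult_one_mat right_mult_one_mat)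
qed

text \<open>For a Clifford unitary \<open>U\<close>, the Paulis that \<open>U\<close> conjugates to diagonal ones; modulo signs
  they form the stabilizer group of the basis measured after \<open>U\<close>.\<close>
definition stab :: "nat \<Rightarrow> complex mat \<Rightarrow> (nat \<Rightarrow> nat) set" where
  "stab n U = {p \<in> pauli_labels n. act n U p \<in> ztype n}"

text \<open>\<open>act n U\<close> is an injective self-map of the finite set of labels, hence a
  bijection, and \<open>stab n U\<close> is its preimage of the diagonal strings.\<close>

lemma card_stab:
  assumes U: "U \<in> clifford n"
  shows "card (stab n U) = 2 ^ n"
proof -
  have inj: "inj_on (act n U) (pauli_labels n)"
    using act_inj[OF U] by (auto intro: inj_onI)
  have "act n U ` pauli_labels n = pauli_labels n"
    using act_label[OF U] by (intro endo_inj_surj inj) auto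
  then have "act n U ` stab n U = ztype n"
    by (auto simp: stab_def ztype_def image_iff)
  then show ?thesis
    using card_image[OF inj_on_subset[OF inj, of "stab n U"]] card_ztype[of n]
    by (auto simp: stab_def)
qed

lemma zero_stab: "U \<in> clifford n \<Longrightarrow> zero_label \<in> stab n U"
  by (simp add: stab_def act_zero zero_ztype)

lemma stab_lcomm:
  assumes "U \<in> clifford n" "p \<in> stab n U" "q \<in> stab n U"
  shows "lcomm n p q = 1"
  using assms lcomm_ztype act_lcomm by (metis (no_types, lifting) mem_Collect_eq stab_def)

text \<open>Links right translation on the group with the action on labels; the invariance of the
  counts below rests on it.\<close>

lemma stab_mult:
  assumes "U \<in> clifford n" "V \<in> clifford n" "p \<in> pauli_labels n"
  shows "p \<in> stab n (U * V) \<longleftrightarrow> act n V p \<in> stab n U"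
  using assms by (auto simp: stab_def act_mult act_label)

text \<open>Distinct labels have distinct images, whose diagonals are orthogonal; for equal labels
  the two signs coincide and their product is 1.\<close>

lemma sum_diag_conj:
  assumes U: "U \<in> clifford n" and p: "p \<in> pauli_labels n" and q: "q \<in> pauli_labels n"
  shows "(\<Sum>b<2 ^ n. conj_by U (pauli n p) $$ (b, b) * conj_by U (pauli n q) $$ (b, b))
    = (if p = q \<and> p \<in> stab n U then 2 ^ n else 0)"
proof -
  obtain c where c: "c\<^sup>2 = 1" "act n U p \<in> pauli_labels n" "conj_by U (pauli n p) = c \<cdot>\<^sub>m pauli n (act n U p)"
    using clifford_act[OF U p] by metis
  obtain c' where c': "c'\<^sup>2 = 1" "act n U q \<in> pauli_labels n" "conj_by U (pauli n q) = c' \<cdot>\<^sub>m pauli n (act n U q)"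
    using clifford_act[OF U q] by metis
  have "(\<Sum>b<2 ^ n. conj_by U (pauli n p) $$ (b, b) * conj_by U (pauli n q) $$ (b, b))
    = c * c' * (\<Sum>b<2 ^ n. pauli n (act n U p) $$ (b, b) * pauli n (act n U q) $$ (b, b))"
    unfolding c(3) c'(3) by (simp add: sum_distrib_left ac_simps)
  also have "\<dots> = c * c' * (if act n U p = act n U q \<and> act n U p \<in> ztype n then 2 ^ n else 0)"
    by (simp add: sum_diag_pauli c c')
  also have "\<dots> = (if p = q \<and> p \<in> stab n U then 2 ^ n else 0)"
  proof (cases "p = q")
    case True
    then have "c' = c" using c c' pauli_smult_cancel by metis
    then show ?thesis using True c(1) p by (simp add: stab_def power2_eq_square)
  next
    case False
    then show ?thesis using act_inj[OF U p q] by auto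
  qed
  finally show ?thesis .
qed

lemma sum_diag_stab:
  assumes U: "U \<in> clifford n" and A: "A \<in> carrier_mat (2 ^ n) (2 ^ n)" and B: "B \<in> carrier_mat (2 ^ n) (2 ^ n)"
  shows "2 ^ n * (\<Sum>b<2 ^ n. conj_by U A $$ (b, b) * conj_by U B $$ (b, b))
    = (\<Sum>p\<in>stab n U. mtrace (A * pauli n p) * mtrace (B * pauli n p))"
proof -
  let ?a = "\<lambda>p. mtrace (A * pauli n p)" and ?b = "\<lambda>p. mtrace (B * pauli n p)"
  let ?D = "\<lambda>p b. conj_by U (pauli n p) $$ (b, b)"
  note U' = cliffordD(2)[OF U]
  \<comment> \<open>Each of the two Pauli expansions carries a factor \<open>2 ^ n\<close>; the
    surplus one cancels against the norm of a diagonal.\<close>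
  have "2 ^ n * (2 ^ n * (\<Sum>b<2 ^ n. conj_by U A $$ (b, b) * conj_by U B $$ (b, b)))
    = (\<Sum>b<2 ^ n. (2 ^ n * conj_by U A $$ (b, b)) * (2 ^ n * conj_by U B $$ (b, b)))"
    by (simp add: sum_distrib_left ac_simps)
  also have "\<dots> = (\<Sum>b<2 ^ n. (\<Sum>p\<in>pauli_labels n. ?a p * ?D p b) * (\<Sum>q\<in>pauli_labels n. ?b q * ?D q b))"
    using U' A B by (intro sum.cong refl) (simp add: conj_by_expansion)
  also have "\<dots> = (\<Sum>b<2 ^ n. \<Sum>p\<in>pauli_labels n. \<Sum>q\<in>pauli_labels n. ?a p * ?b q * (?D p b * ?D q b))"
    by (simp add: sum_product ac_simps)
  also have "\<dots> = (\<Sum>p\<in>pauli_labels n. \<Sum>q\<in>pauli_labels n. \<Sum>b<2 ^ n. ?a p * ?b q * (?D p b * ?D q b))"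
    by (subst sum.swap, rule sum.cong[OF refl], rule sum.swap)
  also have "\<dots> = (\<Sum>p\<in>pauli_labels n. \<Sum>q\<in>pauli_labels n.
      if q = p then (if p \<in> stab n U then ?a p * ?b q * 2 ^ n else 0) else 0)"
    using U by (intro sum.cong refl) (simp add: sum_diag_conj flip: sum_distrib_left)
  also have "\<dots> = (\<Sum>p\<in>pauli_labels n. if p \<in> stab n U then ?a p * ?b p * 2 ^ n else 0)"
    by simp
  also have "\<dots> = (\<Sum>p\<in>stab n U. ?a p * ?b p * 2 ^ n)"
    by (subst sum.inter_filter[symmetric]) (auto simp: stab_def intro!: sum.cong)
  also have "\<dots> = 2 ^ n * (\<Sum>p\<in>stab n U. ?a p * ?b p)"
    by (simp add: sum_distrib_left mult.commute)
  finally show ?thesis by simp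
qed

subsection \<open>Clifford unitaries modulo phases and transitivity\<close>

lemma conj_by_phase:
  assumes "(U, V) \<in> phase_rel n" "A \<in> carrier_mat (2 ^ n) (2 ^ n)"
  shows "conj_by U A = conj_by V A"
proof -
  obtain c where c: "cmod c = 1" "U = c \<cdot>\<^sub>m V" and V: "V \<in> clifford n"
    using assms(1) by (auto simp: phase_rel_def)
  have "c * cnj c = 1" using c(1) by (simp add: complex_norm_square[symmetric])
  have "conj_by U A = (c * cnj c) \<cdot>\<^sub>m conj_by V A"
    unfolding c(2) conj_by_def adj_smult using cliffordD(2)[OF V] assms(2)
    by (simp add: mult_smult_distrib[of _ "2 ^ n" "2 ^ n" _ "2 ^ n"]
        mult_smult_assoc_mat[of _ "2 ^ n" "2 ^ n" _ "2 ^ n"] smult_smult_mat mult.commute)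
  then show ?thesis using \<open>c * cnj c = 1\<close> by (simp add: one_smult_mat)
qed

text \<open>With this, any function of \<open>stab n U\<close> is independent of the representatives
  that \<open>cliff_avg\<close> picks.\<close>

lemma stab_phase: "(U, V) \<in> phase_rel n \<Longrightarrow> stab n U = stab n V"
  by (simp add: stab_def act_def conj_by_phase)

lemma equiv_phase_rel: "equiv (clifford n) (phase_rel n)"
proof (rule equivI)
  show "phase_rel n \<subseteq> clifford n \<times> clifford n" by (auto simp: phase_rel_def)
  show "refl_on (clifford n) (phase_rel n)"
    by (auto simp: refl_on_def phase_rel_def intro!: exI[of _ 1] simp: one_smult_mat)
  show "sym (phase_rel n)"
  proof (rule symI)
    fix U V assume "(U, V) \<in> phase_rel n"
    then obtain c where c: "cmod c = 1" "U = c \<cdot>\<^sub>m V" and UV: "U \<in> clifford n" "V \<in> clifford n"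
      by (auto simp: phase_rel_def)
    have "c \<noteq> 0" using c(1) by auto
    then have "V = inverse c \<cdot>\<^sub>m U" "cmod (inverse c) = 1"
      using c by (simp_all add: smult_smult_mat one_smult_mat norm_inverse)
    then show "(V, U) \<in> phase_rel n" using UV by (auto simp: phase_rel_def)
  qed
  show "trans (phase_rel n)"
  proof (rule transI)
    fix U V W assume "(U, V) \<in> phase_rel n" "(V, W) \<in> phase_rel n"
    then obtain c c' where c: "cmod c = 1" "cmod c' = 1" "U = c \<cdot>\<^sub>m V" "V = c' \<cdot>\<^sub>m W"
      and UV: "U \<in> clifford n" "W \<in> clifford n"
      by (auto simp: phase_rel_def)
    then have "U = (c * c') \<cdot>\<^sub>m W" "cmod (c * c') = 1" by (simp_all add: smult_smult_mat norm_mult)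
    then show "(U, W) \<in> phase_rel n" using UV by (auto simp: phase_rel_def)
  qed
qed

abbreviation cliff_classes :: "nat \<Rightarrow> complex mat set set" where
  "cliff_classes n \<equiv> clifford n // phase_rel n"

definition rep :: "complex mat set \<Rightarrow> complex mat" where
  "rep C = (SOME U. U \<in> C)"

lemma rep_mem: "C \<in> cliff_classes n \<Longrightarrow> rep C \<in> C"
  using in_quotient_imp_non_empty[OF equiv_phase_rel, of C n] some_in_eq[of C] by (simp add: rep_def)

lemma rep_clifford: "C \<in> cliff_classes n \<Longrightarrow> rep C \<in> clifford n"
  using rep_mem in_quotient_imp_subset equiv_phase_rel by blast

lemma rep_class: "U \<in> clifford n \<Longrightarrow> (rep (phase_rel n `` {U}), U) \<in> phase_rel n"
  using rep_mem[OF quotientI[of U "clifford n" "phase_rel n"]] equiv_phase_rel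
  by (auto simp: equiv_def sym_def)

lemma rep_eqI:
  assumes "C \<in> cliff_classes n" "C' \<in> cliff_classes n" "(rep C, rep C') \<in> phase_rel n"
  shows "C = C'"
  using assms rep_mem[OF assms(1)] rep_mem[OF assms(2)] quotient_eqI[OF equiv_phase_rel] by blast

text \<open>The Paulis span all matrices, so conjugation of Paulis determines all products
  \<open>U\<^sub>a\<^sub>i cnj U\<^sub>b\<^sub>j\<close>, that is, \<open>U\<close> up to a phase.\<close>
lemma phase_relI:
  assumes U: "U \<in> clifford n" and V: "V \<in> clifford n"
    and eq: "\<And>p. p \<in> pauli_labels n \<Longrightarrow> conj_by U (pauli n p) = conj_by V (pauli n p)"
  shows "(U, V) \<in> phase_rel n"
proof -
  let ?d = "2 ^ n :: nat"
  note U' = cliffordD[OF U] and V' = cliffordD[OF V]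
  have prods: "U $$ (a, i) * cnj (U $$ (b, j)) = V $$ (a, i) * cnj (V $$ (b, j))"
    if "a < ?d" "b < ?d" "i < ?d" "j < ?d" for a b i j
  proof -
    have "2 ^ n * conj_by U (munit ?d i j) $$ (a, b) = 2 ^ n * conj_by V (munit ?d i j) $$ (a, b)"
      using that U' V'
      by (subst (1 2) conj_by_expansion[symmetric]) (auto simp: eq)
    then show ?thesis using that U' V' by (simp add: conj_by_munit)
  qed
  have norm1: "(\<Sum>b<?d. cnj (W $$ (b, 0)) * W $$ (b, 0)) = 1" if W: "W \<in> clifford n" for W
  proof -
    note W' = cliffordD[OF W]
    have "(adj W * W) $$ (0, 0) = (\<Sum>b<?d. adj W $$ (0, b) * W $$ (b, 0))"
      using W' by (intro mult_index) auto
    then show ?thesis using unitaryD(2)[OF W'(1)] W'(2) by (simp add: adj_index[of _ ?d])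
  qed
  \<comment> \<open>The phase is read off as the inner product of the first columns of
    \<open>V\<close> and \<open>U\<close>; if \<open>U = c V\<close>, it must be this number, as
    these columns have norm 1.\<close>
  define c where "c = (\<Sum>b<?d. cnj (V $$ (b, 0)) * U $$ (b, 0))"
  have entry: "U $$ (a, i) = c * V $$ (a, i)" if "a < ?d" "i < ?d" for a i
  proof -
    have "U $$ (a, i) = (\<Sum>b<?d. (U $$ (a, i) * cnj (U $$ (b, 0))) * U $$ (b, 0))"
      using norm1[OF U] by (simp add: mult.assoc flip: sum_distrib_left)
    also have "\<dots> = (\<Sum>b<?d. (V $$ (a, i) * cnj (V $$ (b, 0))) * U $$ (b, 0))"
      using that by (intro sum.cong refl) (simp add: prods)
    also have "\<dots> = c * V $$ (a, i)"
      by (simp add: c_def mult.assoc flip: sum_distrib_left)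
    finally show ?thesis .
  qed
  have "1 = (\<Sum>b<?d. cnj (U $$ (b, 0)) * U $$ (b, 0))" using norm1[OF U] by simp
  also have "\<dots> = (\<Sum>b<?d. cnj c * c * (cnj (V $$ (b, 0)) * V $$ (b, 0)))"
    by (intro sum.cong refl) (simp add: entry)
  also have "\<dots> = cnj c * c" using norm1[OF V] by (simp flip: sum_distrib_left)
  finally have "of_real ((cmod c)\<^sup>2) = (1::complex)"
    by (simp only: complex_norm_square mult.commute)
  then have "(cmod c)\<^sup>2 = 1" by (simp only: of_real_eq_1_iff)
  then have "cmod c = 1" using norm_ge_zero[of c] by (auto simp: power2_eq_1_iff)
  moreover have "U = c \<cdot>\<^sub>m V"
    using U' V' entry by (intro eq_matI) auto
  ultimately show ?thesis using U V by (auto simp: phase_rel_def)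
qed

text \<open>By \<open>phase_relI\<close> a class is determined by the images of the finitely many
  Paulis, each of which has finitely many possible values. For an infinite quotient
  \<open>card\<close> would be 0 and \<open>cliff_avg\<close> trivially 0.\<close>

lemma finite_cliff_classes: "finite (cliff_classes n)"
proof -
  let ?F = "\<lambda>C. restrict (\<lambda>p. conj_by (rep C) (pauli n p)) (pauli_labels n)"
  let ?B = "\<lambda>p. (\<lambda>(c, q). c \<cdot>\<^sub>m pauli n q) ` ({1, -1, \<i>, -\<i>} \<times> pauli_labels n)"
  have "?F ` cliff_classes n \<subseteq> PiE (pauli_labels n) ?B"
  proof (rule image_subsetI, rule PiE_I)
    fix C p assume C: "C \<in> cliff_classes n" and p: "p \<in> pauli_labels n"
    obtain c q where "c \<in> {1, -1, \<i>, -\<i>}" "q \<in> pauli_labels n" "conj_by (rep C) (pauli n p) = c \<cdot>\<^sub>m pauli n q"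
      using rep_clifford[OF C] p unfolding clifford_def conj_by_def by blast
    then have "conj_by (rep C) (pauli n p) = (\<lambda>(c, q). c \<cdot>\<^sub>m pauli n q) (c, q)"
      "(c, q) \<in> {1, -1, \<i>, -\<i>} \<times> pauli_labels n" by auto
    then show "?F C p \<in> ?B p" unfolding restrict_apply if_P[OF p] by (rule image_eqI)
  qed simp
  moreover have "finite (PiE (pauli_labels n) ?B)" by (intro finite_PiE) auto
  moreover have "inj_on ?F (cliff_classes n)"
  proof (rule inj_onI)
    fix C C' assume C: "C \<in> cliff_classes n" "C' \<in> cliff_classes n" and eq: "?F C = ?F C'"
    have "conj_by (rep C) (pauli n p) = conj_by (rep C') (pauli n p)" if "p \<in> pauli_labels n" for p
      using fun_cong[OF eq, of p] that by simp
    then show "C = C'" using C by (intro rep_eqI phase_relI rep_clifford)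
  qed
  ultimately show ?thesis using finite_subset finite_imageD by blast
qed

lemma card_cliff_classes: "card (cliff_classes n) > 0"
  using finite_cliff_classes[of n] quotientI[OF one_clifford[of n], of "phase_rel n"]
  by (auto simp: card_gt_0_iff)

lemma cliff_avg_rep:
  "cliff_avg n f = (\<Sum>C\<in>cliff_classes n. f (rep C)) / of_nat (card (cliff_classes n))"
  by (simp add: cliff_avg_def rep_def)

text \<open>The uniform distribution is invariant under right translation. Multiplication by
  \<open>V\<close> is injective on the classes, hence onto by finiteness, which avoids showing that
  inverses of Clifford unitaries are Clifford.\<close>

lemma sum_classes_translate:
  assumes V: "V \<in> clifford n" and f: "\<And>U W. (U, W) \<in> phase_rel n \<Longrightarrow> f U = f W"
  shows "(\<Sum>C\<in>cliff_classes n. f (rep C * V)) = (\<Sum>C\<in>cliff_classes n. f (rep C))"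
proof -
  let ?h = "\<lambda>C. phase_rel n `` {rep C * V}"
  have mem: "rep C * V \<in> clifford n" if "C \<in> cliff_classes n" for C
    using that V by (intro clifford_mult rep_clifford)
  have inj: "inj_on ?h (cliff_classes n)"
  proof (rule inj_onI)
    fix C C' assume C: "C \<in> cliff_classes n" "C' \<in> cliff_classes n" and eq: "?h C = ?h C'"
    have "(rep C * V, rep C' * V) \<in> phase_rel n"
      using eq eq_equiv_class[OF eq equiv_phase_rel mem] C by blast
    then obtain c where c: "cmod c = 1" "rep C * V = c \<cdot>\<^sub>m (rep C' * V)"
      by (auto simp: phase_rel_def)
    note V' = cliffordD[OF V]
    have cancel: "rep D * V * adj V = rep D" if "D \<in> cliff_classes n" for D
      using V' cliffordD[OF rep_clifford[OF that]] unitaryD[OF V'(1)]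
      by (simp add: assoc_mult_mat[of _ "2 ^ n" "2 ^ n" _ "2 ^ n" _ "2 ^ n"])
    have "rep C = c \<cdot>\<^sub>m (rep C' * V) * adj V"
      using cancel[OF C(1)] c(2) by simp
    also have "\<dots> = c \<cdot>\<^sub>m (rep C' * V * adj V)"
      using V' cliffordD[OF rep_clifford[OF C(2)]]
      by (intro mult_smult_assoc_mat[of _ "2 ^ n" "2 ^ n" _ "2 ^ n"]) auto
    finally have "rep C = c \<cdot>\<^sub>m rep C'" using cancel[OF C(2)] by simp
    then have "(rep C, rep C') \<in> phase_rel n"
      using c(1) rep_clifford[OF C(1)] rep_clifford[OF C(2)] unfolding phase_rel_def by blast
    then show "C = C'" using C rep_eqI by blast
  qed
  have "?h ` cliff_classes n = cliff_classes n"
    using mem by (intro endo_inj_surj finite_cliff_classes inj) (auto intro: quotientI)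
  then have "(\<Sum>C\<in>cliff_classes n. f (rep C)) = (\<Sum>C\<in>cliff_classes n. f (rep (?h C)))"
    using sum.reindex[OF inj, of "\<lambda>C. f (rep C)"] by (simp add: o_def)
  also have "\<dots> = (\<Sum>C\<in>cliff_classes n. f (rep C * V))"
    using f rep_class mem by (intro sum.cong refl) blast
  finally show ?thesis by simp
qed

text \<open>Conjugation by this unitary realises the symplectic transvection along \<open>lmul p q\<close>;
  in particular it exchanges \<open>p\<close> and \<open>q\<close>.\<close>
definition transv :: "nat \<Rightarrow> (nat \<Rightarrow> nat) \<Rightarrow> (nat \<Rightarrow> nat) \<Rightarrow> complex mat" where
  "transv n p q = complex_of_real (1 / sqrt 2) \<cdot>\<^sub>m (pauli n p + pauli n q)"

lemma adj_transv: "adj (transv n p q) = transv n p q"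
proof -
  have "adj (pauli n p + pauli n q) = adj (pauli n p) + adj (pauli n q)"
    by (rule eq_matI) (auto simp: adj_def)
  then show ?thesis by (simp add: transv_def adj_smult adj_pauli)
qed

lemma transv_carrier [simp]: "transv n p q \<in> carrier_mat (2 ^ n) (2 ^ n)"
  by (simp add: transv_def)

lemma lcomm_neqD:
  assumes "lcomm n p r \<noteq> lcomm n q r"
  shows "lcomm n q r = - lcomm n p r"
  using assms lcomm_values[of n p r] lcomm_values[of n q r] by auto

text \<open>Expand \<open>(P + Q) R (P + Q) / 2\<close>. The terms \<open>P R P\<close> and
  \<open>Q R Q\<close> are multiples of \<open>R\<close>, while \<open>P R Q\<close> and
  \<open>Q R P\<close> are multiples of \<open>R P Q\<close> with an extra minus sign from
  \<open>Q P = - P Q\<close>. If \<open>R\<close> has the same sign with \<open>P\<close> and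
  \<open>Q\<close>, the mixed terms cancel, otherwise the pure ones do.\<close>

lemma conj_transv:
  assumes p: "p \<in> pauli_labels n" and q: "q \<in> pauli_labels n" and r: "r \<in> pauli_labels n"
    and anti: "lcomm n p q = -1"
  shows "conj_by (transv n p q) (pauli n r) = (if lcomm n p r = lcomm n q r
      then complex_of_real (lcomm n p r) \<cdot>\<^sub>m pauli n r
      else (complex_of_real (lcomm n p r) * (lphase n p q * lphase n r (lmul p q))) \<cdot>\<^sub>m pauli n (lmul r (lmul p q)))"
proof -
  let ?D = "2 ^ n :: nat"
  let ?P = "pauli n p" and ?Q = "pauli n q" and ?R = "pauli n r"
  let ?a = "complex_of_real (lcomm n p r)" and ?b = "complex_of_real (lcomm n q r)"
  define T where "T = (lphase n p q * lphase n r (lmul p q)) \<cdot>\<^sub>m pauli n (lmul r (lmul p q))"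
  have T: "?R * (?P * ?Q) = T"
    using assms by (simp add: T_def pauli_mult mult_smult_distrib[of _ ?D ?D _ ?D] smult_smult_mat)
  have anti': "?Q * ?P = (-1) \<cdot>\<^sub>m (?P * ?Q)"
    using pauli_commute[OF q p] anti lcomm_commute[of n p q] by simp
  have PRQ: "?P * ?R * ?Q = ?a \<cdot>\<^sub>m T"
    using p r by (simp add: pauli_commute[of p n r] mult_smult_assoc_mat[of _ ?D ?D _ ?D]
        assoc_mult_mat[of _ ?D ?D _ ?D _ ?D] T)
  have "?Q * ?R * ?P = ?b \<cdot>\<^sub>m (?R * (?Q * ?P))"
    using q r by (simp add: pauli_commute[of q n r] mult_smult_assoc_mat[of _ ?D ?D _ ?D]
        assoc_mult_mat[of _ ?D ?D _ ?D _ ?D])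
  then have QRP: "?Q * ?R * ?P = (- ?b) \<cdot>\<^sub>m T"
    by (simp add: anti' mult_smult_distrib[of _ ?D ?D _ ?D] T smult_smult_mat)
  have [simp]: "T \<in> carrier_mat ?D ?D" by (simp add: T_def)
  have "conj_by (transv n p q) ?R = complex_of_real (1 / sqrt 2) \<cdot>\<^sub>m (?P + ?Q) * ?R
      * (complex_of_real (1 / sqrt 2) \<cdot>\<^sub>m (?P + ?Q))"
    by (simp add: conj_by_def adj_transv) (simp add: transv_def)
  also have "\<dots> = (complex_of_real (1 / sqrt 2) * complex_of_real (1 / sqrt 2)) \<cdot>\<^sub>m ((?P + ?Q) * ?R * (?P + ?Q))"
    by (simp add: mult_smult_distrib[of _ ?D ?D _ ?D] mult_smult_assoc_mat[of _ ?D ?D _ ?D] smult_smult_mat)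
  also have "complex_of_real (1 / sqrt 2) * complex_of_real (1 / sqrt 2) = 1 / 2"
    by (subst of_real_mult[symmetric]) simp
  also have "(?P + ?Q) * ?R * (?P + ?Q) = (?P * ?R * ?P + ?Q * ?R * ?P) + (?P * ?R * ?Q + ?Q * ?R * ?Q)"
    by (simp add: add_mult_distrib_mat[of _ ?D ?D _ _ ?D] mult_add_distrib_mat[of _ ?D ?D _ ?D])
  also have "\<dots> = (?a \<cdot>\<^sub>m ?R + (- ?b) \<cdot>\<^sub>m T) + (?a \<cdot>\<^sub>m T + ?b \<cdot>\<^sub>m ?R)"
    using assms by (simp add: pauli_conj PRQ QRP)
  finally have eq: "conj_by (transv n p q) ?R = (1 / 2) \<cdot>\<^sub>m ((?a \<cdot>\<^sub>m ?R + (- ?b) \<cdot>\<^sub>m T) + (?a \<cdot>\<^sub>m T + ?b \<cdot>\<^sub>m ?R))" .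
  show ?thesis
  proof (cases "lcomm n p r = lcomm n q r")
    case True
    then have "conj_by (transv n p q) ?R = ?a \<cdot>\<^sub>m ?R"
      unfolding eq by (intro eq_matI) (auto simp: carrier_matD[of T ?D ?D])
    then show ?thesis using True by simp
  next
    case False
    then have "lcomm n q r = - lcomm n p r" by (rule lcomm_neqD)
    then have "conj_by (transv n p q) ?R = ?a \<cdot>\<^sub>m T"
      unfolding eq by (intro eq_matI) (auto simp: carrier_matD[of T ?D ?D])
    then show ?thesis using False by (simp add: T_def smult_smult_mat)
  qed
qed

lemma phase_mult_closed:
  assumes "a \<in> {1, -1, \<i>, -\<i>}" "b \<in> {1, -1, \<i>, -\<i>}"
  shows "a * b \<in> {1, -1, \<i>, -\<i> :: complex}"
  using assms by auto

lemma lcomm_phase: "complex_of_real (lcomm n p q) \<in> {1, -1, \<i>, -\<i>}"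
  using lcomm_values[of n p q] by auto

lemma transv_clifford:
  assumes p: "p \<in> pauli_labels n" and q: "q \<in> pauli_labels n" and anti: "lcomm n p q = -1"
  shows "transv n p q \<in> clifford n"
proof -
  \<comment> \<open>\<open>conj_transv\<close> at the identity string gives the square, which
    suffices as \<open>transv\<close> is self-adjoint.\<close>
  have "transv n p q * transv n p q = 1\<^sub>m (2 ^ n)"
    using conj_transv[OF p q zero_label anti]
    by (simp add: pauli_zero_label conj_by_def adj_transv right_mult_one_mat[of _ "2 ^ n" "2 ^ n"] one_smult_mat)
  then have unitary: "unitary (2 ^ n) (transv n p q)"
    by (simp add: unitary_def adj_transv)
  have "\<exists>c s. c \<in> {1, -1, \<i>, -\<i>} \<and> s \<in> pauli_labels n \<and> conj_by (transv n p q) (pauli n r) = c \<cdot>\<^sub>m pauli n s"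
    if r: "r \<in> pauli_labels n" for r
  proof (cases "lcomm n p r = lcomm n q r")
    case True
    then show ?thesis using conj_transv[OF p q r anti] r lcomm_phase by (metis (no_types, lifting))
  next
    case False
    have "complex_of_real (lcomm n p r) * (lphase n p q * lphase n r (lmul p q)) \<in> {1, -1, \<i>, -\<i>}"
      by (intro phase_mult_closed lcomm_phase lphase_values)
    moreover have "lmul r (lmul p q) \<in> pauli_labels n" using p q r by simp
    ultimately show ?thesis using conj_transv[OF p q r anti] False by (metis (no_types, lifting))
  qed
  then show ?thesis using unitary unfolding clifford_def conj_by_def by blast
qed

lemma act_transv_fix:
  assumes p: "p \<in> pauli_labels n" and q: "q \<in> pauli_labels n" and r: "r \<in> pauli_labels n"
    and anti: "lcomm n p q = -1" and eq: "lcomm n p r = lcomm n q r"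
  shows "act n (transv n p q) r = r"
proof (rule act_eqI)
  show "conj_by (transv n p q) (pauli n r) = complex_of_real (lcomm n p r) \<cdot>\<^sub>m pauli n r"
    using conj_transv[OF p q r anti] eq by simp
  show "complex_of_real (lcomm n p r) \<noteq> 0" using lcomm_values[of n p r] by auto
qed (rule r)

lemma act_transv_swap:
  assumes p: "p \<in> pauli_labels n" and q: "q \<in> pauli_labels n" and anti: "lcomm n p q = -1"
  shows "act n (transv n p q) p = q"
proof (rule act_eqI)
  let ?c = "complex_of_real (lcomm n p p) * (lphase n p q * lphase n p (lmul p q))"
  \<comment> \<open>\<open>p\<close> commutes with itself but not with \<open>q\<close>, so the
    second case of \<open>conj_transv\<close> applies, and \<open>p\<close> times \<open>p q\<close>
    is \<open>q\<close>.\<close>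
  show "conj_by (transv n p q) (pauli n p) = ?c \<cdot>\<^sub>m pauli n q"
    using conj_transv[OF p q p anti] anti lcomm_commute[of n p q] p q by (simp add: lmul_lmul_cancel)
  have "?c \<in> {1, -1, \<i>, -\<i>}" by (intro phase_mult_closed lcomm_phase lphase_values)
  then show "?c \<noteq> 0" by fastforce
qed (rule q)

text \<open>Counting with characters: every term of the expanded product that may contribute
  negatively sums to zero.\<close>
lemma ex_anticommuting_label:
  assumes p: "p \<in> pauli_labels n" and q: "q \<in> pauli_labels n" and r: "r \<in> pauli_labels n"
    and ne: "q \<noteq> zero_label" "r \<noteq> zero_label" "q \<noteq> p" "r \<noteq> p"
  obtains s where "s \<in> pauli_labels n" "lcomm n s p = 1" "lcomm n s q = -1" "lcomm n s r = -1"
proof -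
  let ?L = "pauli_labels n"
  \<comment> \<open>Takes the value 8 at the labels sought and 0 at all others.\<close>
  let ?f = "\<lambda>s. (1 + lcomm n s p) * ((1 - lcomm n s q) * (1 - lcomm n s r))"
  have "(\<Sum>s\<in>?L. ?f s) = (\<Sum>s\<in>?L. lcomm n s zero_label - lcomm n s q - lcomm n s r + lcomm n s (lmul q r)
      + lcomm n s p - lcomm n s (lmul p q) - lcomm n s (lmul p r) + lcomm n s (lmul p (lmul q r)))"
    using p q r by (intro sum.cong refl) (simp add: lcomm_lmul algebra_simps)
  also have "\<dots> \<ge> (2 ^ n)\<^sup>2"
    using p q r ne by (simp add: sum.distrib sum_subtractf sum_lcomm lmul_eq_zero_iff card_pauli_labels)
  finally have "(\<Sum>s\<in>?L. ?f s) > 0" by (smt (verit) zero_less_power zero_less_numeral)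
  then have "\<not> (\<forall>s\<in>?L. ?f s = 0)" using sum.neutral[of ?L ?f] by linarith
  then obtain s where s: "s \<in> ?L" "?f s \<noteq> 0" by blast
  then have "lcomm n s p = 1" "lcomm n s q = -1" "lcomm n s r = -1"
    using lcomm_values[of n s p] lcomm_values[of n s q] lcomm_values[of n s r] by auto
  then show ?thesis using that s(1) by blast
qed

text \<open>If \<open>q\<close> and \<open>r\<close> anticommute, the transvection that exchanges
  them fixes \<open>p\<close>, which commutes with both. Otherwise an intermediate \<open>s\<close>
  that anticommutes with both and commutes with \<open>p\<close> gives two such steps. Allowing
  \<open>p = zero_label\<close> also covers transitivity on single non-identity labels.\<close>

lemma clifford_transitive:
  assumes p: "p \<in> pauli_labels n" and q: "q \<in> pauli_labels n" and r: "r \<in> pauli_labels n"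
    and comm: "lcomm n p q = 1" "lcomm n p r = 1"
    and ne: "q \<noteq> zero_label" "r \<noteq> zero_label" "q \<noteq> p" "r \<noteq> p"
  obtains V where "V \<in> clifford n" "act n V p = p" "act n V q = r"
proof -
  consider "lcomm n q r = -1" | "lcomm n q r = 1"
    using lcomm_values[of n q r] by blast
  then show ?thesis
  proof cases
    case 1
    have "lcomm n q p = lcomm n r p" using comm by (simp add: lcomm_commute)
    then show ?thesis using that[of "transv n q r"] p q r 1
      by (simp add: transv_clifford act_transv_fix act_transv_swap)
  next
    case 2
    obtain s where s: "s \<in> pauli_labels n" "lcomm n s p = 1" "lcomm n s q = -1" "lcomm n s r = -1"
      using ex_anticommuting_label[OF p q r ne] by blast
    have qs: "lcomm n q s = -1" and c: "lcomm n q p = lcomm n s p" "lcomm n s p = lcomm n r p"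
      using s comm by (simp_all add: lcomm_commute[of n q] lcomm_commute[of n r p])
    note cl = transv_clifford[OF q s(1) qs] transv_clifford[OF s(1) r s(4)]
    show ?thesis
      using that[OF clifford_mult[OF cl(2,1)]] p q r s c qs
      by (simp add: act_mult[OF cl(2,1)] act_transv_fix act_transv_swap)
  qed
qed

subsection \<open>Averages over the Clifford group\<close>

text \<open>Joint frequency of two labels, not yet normalised; the diagonal
  \<open>stab_count n p p\<close> holds the frequencies of single labels.\<close>

definition stab_count :: "nat \<Rightarrow> (nat \<Rightarrow> nat) \<Rightarrow> (nat \<Rightarrow> nat) \<Rightarrow> real" where
  "stab_count n p q = (\<Sum>C\<in>cliff_classes n. if p \<in> stab n (rep C) \<and> q \<in> stab n (rep C) then 1 else 0)"

text \<open>Translating all classes by \<open>V\<close> on the right turns membership of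
  \<open>p\<close> into membership of \<open>act n V p\<close>.\<close>

lemma stab_count_act:
  assumes V: "V \<in> clifford n" and p: "p \<in> pauli_labels n" and q: "q \<in> pauli_labels n"
  shows "stab_count n (act n V p) (act n V q) = stab_count n p q"
proof -
  have "stab_count n p q = (\<Sum>C\<in>cliff_classes n. if p \<in> stab n (rep C * V) \<and> q \<in> stab n (rep C * V) then 1 else 0)"
    unfolding stab_count_def
    by (rule sum_classes_translate[OF V, of "\<lambda>U. if p \<in> stab n U \<and> q \<in> stab n U then 1 else 0", symmetric])
      (simp add: stab_phase)
  also have "\<dots> = stab_count n (act n V p) (act n V q)"
    unfolding stab_count_def using V p q
    by (intro sum.cong refl) (simp add: stab_mult rep_clifford)
  finally show ?thesis by simp
qed

lemma stab_count_zero: "stab_count n zero_label q = stab_count n q q"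
  unfolding stab_count_def by (intro sum.cong refl) (simp add: zero_stab rep_clifford)

lemma stab_count_zero_zero: "stab_count n zero_label zero_label = card (cliff_classes n)"
  unfolding stab_count_def by (simp add: zero_stab rep_clifford)

text \<open>Double counting: each class whose stabilizer contains \<open>p\<close> contributes the
  \<open>2 ^ n\<close> elements of that stabilizer.\<close>

lemma sum_stab_count:
  "(\<Sum>q\<in>pauli_labels n. stab_count n p q) = 2 ^ n * stab_count n p p"
proof -
  have "(\<Sum>q\<in>pauli_labels n. if p \<in> stab n (rep C) \<and> q \<in> stab n (rep C) then 1 else 0)
    = (if p \<in> stab n (rep C) then 2 ^ n else (0::real))" if C: "C \<in> cliff_classes n" for C
  proof -
    have "(\<Sum>q\<in>pauli_labels n. if q \<in> stab n (rep C) then 1 else (0::real)) = real (card (stab n (rep C)))"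
      by (subst sum.inter_filter[symmetric]) (auto simp: stab_def intro: arg_cong[where f = card])
    then show ?thesis using card_stab[OF rep_clifford[OF C]] by simp
  qed
  then have "(\<Sum>q\<in>pauli_labels n. stab_count n p q)
    = (\<Sum>C\<in>cliff_classes n. if p \<in> stab n (rep C) then 2 ^ n else 0)"
    unfolding stab_count_def by (subst sum.swap) (intro sum.cong refl)
  also have "\<dots> = 2 ^ n * stab_count n p p"
    unfolding stab_count_def sum_distrib_left by (intro sum.cong refl) simp
  finally show ?thesis .
qed

lemma stab_count_commute: "stab_count n p q = stab_count n q p"
  unfolding stab_count_def by (intro sum.cong refl) auto

lemma stab_count_anticommute:
  assumes "lcomm n p q = -1"
  shows "stab_count n p q = 0"
  unfolding stab_count_def using assms stab_lcomm[OF rep_clifford, of _ n p q]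
  by (intro sum.neutral) auto

lemma stab_count_diag:
  assumes n: "n \<ge> 1" and p: "p \<in> pauli_labels n" "p \<noteq> zero_label"
  shows "stab_count n p p = card (cliff_classes n) / (2 ^ n + 1)"
proof -
  let ?L = "pauli_labels n" and ?N = "real (card (cliff_classes n))" and ?d = "2 ^ n :: real"
  have const: "stab_count n q q = stab_count n p p" if q: "q \<in> ?L" "q \<noteq> zero_label" for q
  proof -
    \<comment> \<open>The transitivity on pairs, with the identity as the fixed first label.\<close>
    obtain V where "V \<in> clifford n" "act n V p = q"
      using clifford_transitive[OF zero_label p(1) q(1)] p(2) q(2) by auto
    then show ?thesis using stab_count_act p(1) by blast
  qed
  have "?d * ?N = (\<Sum>q\<in>?L. stab_count n zero_label q)"
    by (simp add: sum_stab_count stab_count_zero_zero)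
  also have "\<dots> = ?N + (\<Sum>q\<in>?L - {zero_label}. stab_count n zero_label q)"
    by (simp add: stab_count_zero_zero sum.remove[of ?L zero_label])
  also have "(\<Sum>q\<in>?L - {zero_label}. stab_count n zero_label q) = (\<Sum>q\<in>?L - {zero_label}. stab_count n p p)"
    unfolding stab_count_zero by (intro sum.cong refl const) auto
  also have "\<dots> = (?d\<^sup>2 - 1) * stab_count n p p"
    by (simp add: card_Diff_singleton card_pauli_labels of_nat_diff)
  finally have "(?d - 1) * ?N = (?d - 1) * ((?d + 1) * stab_count n p p)"
    by (simp add: algebra_simps power2_eq_square)
  \<comment> \<open>This is where \<open>n \<ge> 1\<close> enters: it permits cancelling
    \<open>?d - 1\<close>.\<close>
  moreover have "?d > 1" using n by (simp add: one_less_power)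
  ultimately have "?N = (?d + 1) * stab_count n p p" by simp
  then show ?thesis using \<open>?d > 1\<close> by (simp add: field_simps)
qed

lemma stab_count_offdiag:
  assumes n: "n \<ge> 1" and p: "p \<in> pauli_labels n" "p \<noteq> zero_label"
    and q: "q \<in> pauli_labels n" "q \<noteq> zero_label" "q \<noteq> p" and comm: "lcomm n p q = 1"
  shows "stab_count n p q = 2 * card (cliff_classes n) / ((2 ^ n + 1) * (2 ^ n + 2))"
proof -
  let ?L = "pauli_labels n" and ?N = "real (card (cliff_classes n))" and ?d = "2 ^ n :: real"
  \<comment> \<open>The indicator of commuting with \<open>p\<close>, written as a character so that
    \<open>sum_lcomm\<close> counts its support.\<close>
  let ?w = "\<lambda>r. (1 + lcomm n r p) / 2"
  define m where "m = stab_count n p p"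
  have d: "?d > 1" using n by (simp add: one_less_power)
  have const: "stab_count n p r = ?w r * stab_count n p q" if r: "r \<in> ?L - {zero_label} - {p}" for r
  proof (cases "lcomm n p r = 1")
    case True
    obtain V where "V \<in> clifford n" "act n V p = p" "act n V q = r"
      using clifford_transitive[OF p(1) q(1), of r] comm True q r by auto
    then have "stab_count n p r = stab_count n p q" using stab_count_act p(1) q(1) by metis
    then show ?thesis using True by (simp add: lcomm_commute)
  next
    case False
    then have "lcomm n p r = -1" using lcomm_values by blast
    then show ?thesis by (simp add: stab_count_anticommute lcomm_commute)
  qed
  have split: "(\<Sum>r\<in>?L. g r) = g zero_label + (g p + (\<Sum>r\<in>?L - {zero_label} - {p}. g r))" for g :: "_ \<Rightarrow> real"
    using p by (subst sum.remove[of _ zero_label], simp, simp, subst sum.remove[of _ p]) auto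
  have "(\<Sum>r\<in>?L. ?w r) = ?d\<^sup>2 / 2"
    using p by (simp add: sum.distrib sum_lcomm card_pauli_labels flip: sum_divide_distrib)
  then have w: "(\<Sum>r\<in>?L - {zero_label} - {p}. ?w r) = ?d\<^sup>2 / 2 - 2"
    using split[of ?w] by simp
  \<comment> \<open>The factor \<open>?d - 2\<close>, to be cancelled below, vanishes for a single
    qubit. The label \<open>q\<close> itself rules this out: it is counted in
    \<open>?d^2 / 2 - 2\<close>, which is therefore at least 1.\<close>
  have "?w q \<le> (\<Sum>r\<in>?L - {zero_label} - {p}. ?w r)"
  proof (rule member_le_sum)
    show "0 \<le> ?w r" for r using lcomm_values[of n r p] by auto
  qed (use q in auto)
  then have "?d\<^sup>2 > 2\<^sup>2" using w comm by (simp add: lcomm_commute)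
  then have "?d > 2" using power_less_imp_less_base[of 2 2 ?d] by simp
  have "?d * m = (\<Sum>r\<in>?L. stab_count n p r)"
    by (simp add: sum_stab_count m_def)
  also have "\<dots> = 2 * m + (\<Sum>r\<in>?L - {zero_label} - {p}. stab_count n p r)"
    unfolding split by (simp add: stab_count_commute[of n p zero_label] stab_count_zero m_def)
  also have "(\<Sum>r\<in>?L - {zero_label} - {p}. stab_count n p r)
      = (\<Sum>r\<in>?L - {zero_label} - {p}. ?w r * stab_count n p q)"
    by (intro sum.cong refl const)
  also have "\<dots> = (?d\<^sup>2 / 2 - 2) * stab_count n p q"
    by (simp only: w flip: sum_distrib_right)
  finally have "(?d - 2) * (2 * m) = (?d - 2) * ((?d + 2) * stab_count n p q)"
    by (simp add: algebra_simps power2_eq_square)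
  then have "2 * m = (?d + 2) * stab_count n p q" using \<open>?d > 2\<close> by simp
  then have "stab_count n p q = 2 * m / (?d + 2)" using d by simp
  moreover have "m = ?N / (?d + 1)" using stab_count_diag[OF n p] by (simp add: m_def)
  ultimately show ?thesis by simp
qed

text \<open>The numerators are \<open>d + 2\<close>, 2 and 0 for equal, distinct commuting and
  anticommuting labels. An expression linear in \<open>lcomm\<close> replaces the case distinction,
  so that double sums over labels split.\<close>

lemma stab_count_eq:
  assumes n: "n \<ge> 1" and p: "p \<in> pauli_labels n" "p \<noteq> zero_label"
    and q: "q \<in> pauli_labels n" "q \<noteq> zero_label"
  shows "stab_count n p q / card (cliff_classes n)
    = (1 + lcomm n p q + (if p = q then 2 ^ n else 0)) / ((2 ^ n + 1) * (2 ^ n + 2))"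
proof -
  have N: "real (card (cliff_classes n)) \<noteq> 0" using card_cliff_classes[of n] by simp
  have d: "(2::real) ^ n > 0" by simp
  consider "p = q" | "p \<noteq> q" "lcomm n p q = 1" | "p \<noteq> q" "lcomm n p q = -1"
    using lcomm_values by blast
  then show ?thesis
  proof cases
    case 1
    have "(2::real) ^ n + 2 \<noteq> 0" using d by linarith
    then have "(1 + 1 + (2::real) ^ n) / ((2 ^ n + 1) * (2 ^ n + 2)) = 1 / (2 ^ n + 1)"
      by (simp add: divide_simps)
    then show ?thesis using 1 N stab_count_diag[OF n p] by simp
  next
    case 2
    then show ?thesis using N stab_count_offdiag[OF n p q] by simp
  next
    case 3
    then show ?thesis by (simp add: stab_count_anticommute)
  qed
qed

section \<open>First and second moments, and the measurement channel\<close>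

lemma cliff_avg_cong:
  assumes "\<And>U. U \<in> clifford n \<Longrightarrow> f U = g U"
  shows "cliff_avg n f = cliff_avg n g"
  unfolding cliff_avg_rep using assms rep_clifford by (metis (no_types, lifting) sum.cong)

text \<open>Replaces an index set that depends on \<open>U\<close> by a fixed one, so that sums over
  labels and over classes can be exchanged.\<close>

lemma sum_stab_indicator:
  "(\<Sum>p\<in>stab n U. f p) = (\<Sum>p\<in>pauli_labels n. (if p \<in> stab n U then 1 else 0) * (f p :: complex))"
proof -
  have "(\<Sum>p\<in>pauli_labels n. (if p \<in> stab n U then 1 else 0) * f p) = (\<Sum>p\<in>pauli_labels n. if p \<in> stab n U then f p else 0)"
    by (intro sum.cong refl) simp
  also have "\<dots> = (\<Sum>p\<in>stab n U. f p)"
    by (subst sum.inter_filter[symmetric]) (auto simp: stab_def intro!: sum.cong)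
  finally show ?thesis by simp
qed

lemma cliff_avg_stab:
  "cliff_avg n (\<lambda>U. \<Sum>p\<in>stab n U. f p)
    = (\<Sum>p\<in>pauli_labels n. complex_of_real (stab_count n p p / card (cliff_classes n)) * f p)"
proof -
  have "(\<Sum>C\<in>cliff_classes n. \<Sum>p\<in>stab n (rep C). f p)
    = (\<Sum>p\<in>pauli_labels n. \<Sum>C\<in>cliff_classes n. (if p \<in> stab n (rep C) then 1 else 0) * f p)"
    unfolding sum_stab_indicator by (rule sum.swap)
  also have "\<dots> = (\<Sum>p\<in>pauli_labels n. complex_of_real (stab_count n p p) * f p)"
    by (intro sum.cong refl) (simp add: stab_count_def sum_distrib_right if_distrib[of complex_of_real] cong: if_cong)
  finally show ?thesis by (simp add: cliff_avg_rep sum_divide_distrib)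
qed

lemma cliff_avg_stab_square:
  "cliff_avg n (\<lambda>U. (\<Sum>p\<in>stab n U. f p)\<^sup>2)
    = (\<Sum>p\<in>pauli_labels n. \<Sum>q\<in>pauli_labels n. complex_of_real (stab_count n p q / card (cliff_classes n)) * (f p * f q))"
proof -
  have "(\<Sum>C\<in>cliff_classes n. (\<Sum>p\<in>stab n (rep C). f p)\<^sup>2)
    = (\<Sum>C\<in>cliff_classes n. \<Sum>p\<in>pauli_labels n. \<Sum>q\<in>pauli_labels n.
        (if p \<in> stab n (rep C) \<and> q \<in> stab n (rep C) then 1 else 0) * (f p * f q))"
    unfolding sum_stab_indicator power2_eq_square sum_product
    by (intro sum.cong refl) simp
  also have "\<dots> = (\<Sum>p\<in>pauli_labels n. \<Sum>q\<in>pauli_labels n. \<Sum>C\<in>cliff_classes n.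
        (if p \<in> stab n (rep C) \<and> q \<in> stab n (rep C) then 1 else 0) * (f p * f q))"
    by (subst sum.swap, rule sum.cong[OF refl], rule sum.swap)
  also have "\<dots> = (\<Sum>p\<in>pauli_labels n. \<Sum>q\<in>pauli_labels n. complex_of_real (stab_count n p q) * (f p * f q))"
    by (intro sum.cong refl) (simp add: stab_count_def sum_distrib_right if_distrib[of complex_of_real] cong: if_cong)
  finally show ?thesis by (simp add: cliff_avg_rep sum_divide_distrib)
qed

text \<open>By the first moment the channel is depolarising: each non-identity Pauli is damped by
  \<open>1/(d+1)\<close> and the identity is kept.\<close>

lemma meas_channel_eq:
  assumes n: "n \<ge> 1" and X: "X \<in> carrier_mat (2 ^ n) (2 ^ n)" and ij: "i < 2 ^ n" "j < 2 ^ n"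
  shows "meas_channel n X $$ (i, j) = (X $$ (i, j) + mtrace X * (if i = j then 1 else 0)) / (2 ^ n + 1)"
proof -
  let ?L = "pauli_labels n" and ?d = "2 ^ n :: complex"
  let ?f = "\<lambda>p. mtrace (X * pauli n p) * pauli n p $$ (i, j) / ?d"
  have d1: "?d + 1 \<noteq> 0"
  proof -
    have "?d + 1 = of_nat (2 ^ n + 1)" by simp
    then show ?thesis by (metis of_nat_eq_0_iff add_is_0 one_neq_zero)
  qed
  have "meas_channel n X $$ (i, j) = cliff_avg n (\<lambda>U. \<Sum>p\<in>stab n U. ?f p)"
    unfolding meas_channel_def using ij
  proof (simp, intro cliff_avg_cong)
    fix U assume U: "U \<in> clifford n"
    note U' = cliffordD[OF U]
    \<comment> \<open>The indices of \<open>munit\<close> are reversed because the diagonal entry of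
      the conjugate of \<open>|j><i|\<close> is
      \<open>U $$ (b,j) * cnj (U $$ (b,i))\<close>.\<close>
    have "(\<Sum>b<2 ^ n. (U * X * adj U) $$ (b, b) * (cnj (U $$ (b, i)) * U $$ (b, j)))
      = (\<Sum>b<2 ^ n. conj_by U X $$ (b, b) * conj_by U (munit (2 ^ n) j i) $$ (b, b))"
      using U' ij by (intro sum.cong refl) (simp add: conj_by_munit, simp add: conj_by_def)
    also have "\<dots> = (\<Sum>p\<in>stab n U. ?f p)"
      using sum_diag_stab[OF U X munit_carrier, of j i] ij
      by (simp add: mtrace_munit[of _ "2 ^ n"] field_simps flip: sum_divide_distrib)
    finally show "(\<Sum>b<2 ^ n. (U * X * adj U) $$ (b, b) * (cnj (U $$ (b, i)) * U $$ (b, j))) = (\<Sum>p\<in>stab n U. ?f p)" .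
  qed
  also have "\<dots> = (\<Sum>p\<in>?L. complex_of_real (stab_count n p p / card (cliff_classes n)) * ?f p)"
    by (rule cliff_avg_stab)
  \<comment> \<open>The weight 1 of the identity is split as \<open>(1 + d)/(d + 1)\<close>: the
    first part completes the Pauli expansion of \<open>X\<close>, the second becomes the trace
    term.\<close>
  also have "\<dots> = (\<Sum>p\<in>?L. (?f p + (if p = zero_label then ?d * ?f p else 0)) / (?d + 1))"
  proof (intro sum.cong refl)
    fix p assume p: "p \<in> ?L"
    show "complex_of_real (stab_count n p p / card (cliff_classes n)) * ?f p
      = (?f p + (if p = zero_label then ?d * ?f p else 0)) / (?d + 1)"
    proof (cases "p = zero_label")
      case True
      then have c1: "stab_count n p p / card (cliff_classes n) = 1"
        using card_cliff_classes[of n] by (simp add: stab_count_zero_zero)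
      have "x = (x + ?d * x) / (?d + 1)" for x
        unfolding nonzero_eq_divide_eq[OF d1] by (simp add: algebra_simps)
      then show ?thesis unfolding c1 if_P[OF True] of_real_1 mult_1_left .
    next
      case False
      then have "stab_count n p p / card (cliff_classes n) = 1 / (2 ^ n + 1)"
        using card_cliff_classes[of n] stab_count_diag[OF n p] by simp
      then show ?thesis using False by simp
    qed
  qed
  also have "\<dots> = ((\<Sum>p\<in>?L. ?f p) + ?d * ?f zero_label) / (?d + 1)"
    by (simp add: sum.distrib flip: sum_divide_distrib)
  also have "(\<Sum>p\<in>?L. ?f p) = X $$ (i, j)"
    using pauli_expansion[OF X ij] by (simp flip: sum_divide_distrib)
  also have "?d * ?f zero_label = mtrace X * (if i = j then 1 else 0)"
    using ij X by (simp add: pauli_zero_label)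
  finally show ?thesis .
qed

text \<open>As the inverse is a definite description, both parts are needed: \<open>(d+1) Y\<close>
  is a preimage because \<open>Y\<close> is traceless, and any preimage is shown to be traceless
  too, hence equal to it.\<close>

lemma meas_channel_inv_traceless:
  assumes n: "n \<ge> 1" and Y: "Y \<in> carrier_mat (2 ^ n) (2 ^ n)" and tr: "mtrace Y = 0"
  shows "meas_channel_inv n Y = (2 ^ n + 1) \<cdot>\<^sub>m Y"
  unfolding meas_channel_inv_def
proof (rule the_equality)
  let ?d = "2 ^ n :: complex"
  have d1: "?d + 1 \<noteq> 0"
  proof -
    have "?d + 1 = of_nat (2 ^ n + 1)" by simp
    then show ?thesis by (metis of_nat_eq_0_iff add_is_0 one_neq_zero)
  qed
  have dims: "dim_row (meas_channel n X) = 2 ^ n" "dim_col (meas_channel n X) = 2 ^ n" for X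
    by (simp_all add: meas_channel_def)
  have "meas_channel n ((?d + 1) \<cdot>\<^sub>m Y) = Y"
    using Y d1 by (intro eq_matI) (auto simp: dims meas_channel_eq[OF n] mtrace_smult tr)
  then show "(?d + 1) \<cdot>\<^sub>m Y \<in> carrier_mat (2 ^ n) (2 ^ n) \<and> meas_channel n ((?d + 1) \<cdot>\<^sub>m Y) = Y"
    using Y by simp
  fix X assume "X \<in> carrier_mat (2 ^ n) (2 ^ n) \<and> meas_channel n X = Y"
  then have X: "X \<in> carrier_mat (2 ^ n) (2 ^ n)" and XY: "meas_channel n X = Y" by auto
  have entry: "X $$ (i, j) + mtrace X * (if i = j then 1 else 0) = (?d + 1) * Y $$ (i, j)"
    if "i < 2 ^ n" "j < 2 ^ n" for i j
    using meas_channel_eq[OF n X that] XY d1 by (simp add: field_simps)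
  \<comment> \<open>Taking traces gives \<open>(d+1) tr X = (d+1) tr Y\<close>.\<close>
  have "(\<Sum>i<2 ^ n. X $$ (i, i) + mtrace X) = (\<Sum>i<2 ^ n. (?d + 1) * Y $$ (i, i))"
    using entry by (intro sum.cong refl) fastforce
  then have "(?d + 1) * mtrace X = (?d + 1) * mtrace Y"
    using X Y by (simp add: sum.distrib mtrace_def sum_distrib_left algebra_simps)
  then have "mtrace X = 0" using tr d1 by simp
  then show "X = (?d + 1) \<cdot>\<^sub>m Y"
    using X Y entry by (intro eq_matI) auto
qed

text \<open>The prefactor is \<open>((d+1)/d)^2\<close> times \<open>1/((d+1)(d+2))\<close>:
  \<open>d+1\<close> comes from the inverse channel, \<open>1/d\<close> from
  \<open>sum_diag_stab\<close>, and the rest from \<open>stab_count_eq\<close>.\<close>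

lemma second_moment:
  assumes n: "n \<ge> 1" and R: "R \<in> carrier_mat (2 ^ n) (2 ^ n)"
    and Y: "Y \<in> carrier_mat (2 ^ n) (2 ^ n)" and tr: "mtrace Y = 0"
  shows "cliff_avg n (\<lambda>U. (\<Sum>b<2 ^ n. (U * R * adj U) $$ (b, b) * (U * meas_channel_inv n Y * adj U) $$ (b, b))\<^sup>2)
    = (\<Sum>p\<in>pauli_labels n. \<Sum>q\<in>pauli_labels n.
        complex_of_real ((2 ^ n + 1) / ((2 ^ n)\<^sup>2 * (2 ^ n + 2)) * (1 + lcomm n p q + (if p = q then 2 ^ n else 0)))
        * (Xi2 n R Y p * Xi2 n R Y q))"
proof -
  let ?d = "2 ^ n :: complex" and ?r = "2 ^ n :: real"
  let ?f = "\<lambda>p. (?d + 1) / ?d * Xi2 n R Y p"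
  have "cliff_avg n (\<lambda>U. (\<Sum>b<2 ^ n. (U * R * adj U) $$ (b, b) * (U * meas_channel_inv n Y * adj U) $$ (b, b))\<^sup>2)
    = cliff_avg n (\<lambda>U. (\<Sum>p\<in>stab n U. ?f p)\<^sup>2)"
  proof (rule cliff_avg_cong)
    fix U assume U: "U \<in> clifford n"
    note U' = cliffordD[OF U]
    have "(\<Sum>b<2 ^ n. (U * R * adj U) $$ (b, b) * (U * meas_channel_inv n Y * adj U) $$ (b, b))
      = (\<Sum>b<2 ^ n. conj_by U R $$ (b, b) * conj_by U ((?d + 1) \<cdot>\<^sub>m Y) $$ (b, b))"
      by (simp add: conj_by_def meas_channel_inv_traceless[OF n Y tr])
    also have "\<dots> = (\<Sum>b<2 ^ n. (?d + 1) * (conj_by U R $$ (b, b) * conj_by U Y $$ (b, b)))"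
      using U' Y carrier_matD[OF conj_by_carrier[OF U'(2) Y]]
      by (intro sum.cong refl) (simp add: conj_by_smult[of _ "2 ^ n"])
    also have "\<dots> = (?d + 1) / ?d * (?d * (\<Sum>b<2 ^ n. conj_by U R $$ (b, b) * conj_by U Y $$ (b, b)))"
      by (simp add: sum_distrib_left)
    also have "\<dots> = (\<Sum>p\<in>stab n U. ?f p)"
      unfolding sum_diag_stab[OF U R Y] by (simp only: Xi2_def sum_distrib_left)
    finally show "(\<Sum>b<2 ^ n. (U * R * adj U) $$ (b, b) * (U * meas_channel_inv n Y * adj U) $$ (b, b))\<^sup>2
      = (\<Sum>p\<in>stab n U. ?f p)\<^sup>2" by simp
  qed
  also have "\<dots> = (\<Sum>p\<in>pauli_labels n. \<Sum>q\<in>pauli_labels n.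
      complex_of_real (stab_count n p q / card (cliff_classes n)) * (?f p * ?f q))"
    by (rule cliff_avg_stab_square)
  also have "\<dots> = (\<Sum>p\<in>pauli_labels n. \<Sum>q\<in>pauli_labels n.
        complex_of_real ((?r + 1) / (?r\<^sup>2 * (?r + 2)) * (1 + lcomm n p q + (if p = q then ?r else 0)))
        * (Xi2 n R Y p * Xi2 n R Y q))"
  proof (intro sum.cong refl)
    fix p q assume p: "p \<in> pauli_labels n" and q: "q \<in> pauli_labels n"
    \<comment> \<open>\<open>stab_count_eq\<close> excludes the identity label; there both sides
      vanish since \<open>Y\<close> is traceless.\<close>
    have zero: "Xi2 n R Y zero_label = 0"
      using Y tr by (simp add: Xi2_def pauli_zero_label)
    show "complex_of_real (stab_count n p q / card (cliff_classes n)) * (?f p * ?f q)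
      = complex_of_real ((?r + 1) / (?r\<^sup>2 * (?r + 2)) * (1 + lcomm n p q + (if p = q then ?r else 0)))
        * (Xi2 n R Y p * Xi2 n R Y q)"
    proof (cases "p = zero_label \<or> q = zero_label")
      case True
      then show ?thesis using zero by auto
    next
      case False
      define w where "w = 1 + lcomm n p q + (if p = q then ?r else 0)"
      have pos: "?r > 0" by simp
      have "w / ((?r + 1) * (?r + 2)) * ((?r + 1) / ?r * ((?r + 1) / ?r)) = (?r + 1) / (?r\<^sup>2 * (?r + 2)) * w"
        using pos by (simp add: divide_simps power2_eq_square)
      moreover have "stab_count n p q / card (cliff_classes n) = w / ((?r + 1) * (?r + 2))"
        unfolding w_def using stab_count_eq[OF n p _ q] False by blast
      moreover have "(?d + 1) / ?d = complex_of_real ((?r + 1) / ?r)" by simp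
      moreover have "complex_of_real s * (complex_of_real k * x * (complex_of_real k * y))
          = complex_of_real (s * (k * k)) * (x * y)" for s k x y
        by (simp only: of_real_mult ac_simps)
      ultimately show ?thesis unfolding w_def[symmetric] by (simp only:)
    qed
  qed
  finally show ?thesis .
qed

subsection \<open>The variance\<close>

lemma hermitian_pauli: "hermitian (pauli n p)"
  by (simp add: hermitian_def adj_pauli)

lemma hermitian_index:
  assumes "hermitian A" "A \<in> carrier_mat m m" "i < m" "j < m"
  shows "cnj (A $$ (i, j)) = A $$ (j, i)"
  using adj_index[OF assms(2,4,3)] assms(1) by (simp add: hermitian_def)

lemma cnj_mtrace_hermitian:
  assumes "hermitian A" "hermitian B" "A \<in> carrier_mat m m" "B \<in> carrier_mat m m"
  shows "cnj (mtrace (A * B)) = mtrace (A * B)"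
proof -
  have "cnj (mtrace (A * B)) = (\<Sum>i<m. \<Sum>j<m. A $$ (j, i) * B $$ (i, j))"
    using assms by (simp add: mtrace_mult hermitian_index)
  then show ?thesis using assms by (subst (asm) sum.swap) (simp add: mtrace_mult)
qed

lemma Re_mtrace_hermitian:
  assumes "hermitian A" "hermitian B" "A \<in> carrier_mat m m" "B \<in> carrier_mat m m"
  shows "complex_of_real (Re (mtrace (A * B))) = mtrace (A * B)"
  using cnj_mtrace_hermitian[OF assms] by (metis Reals_cnj_iff of_real_Re)

text \<open>The trace is the sum of the quadratic form of \<open>R\<close> over the columns of
  \<open>B\<close>. Positivity is thus used exactly as \<open>density_op\<close> states it, without
  a spectral decomposition.\<close>

lemma psd_mtrace:
  assumes R: "R \<in> carrier_mat m m" and B: "B \<in> carrier_mat m m"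
    and psd: "\<forall>v\<in>carrier_vec m. 0 \<le> Re (conjugate v \<bullet> (R *\<^sub>v v))"
  shows "0 \<le> Re (mtrace (R * (B * adj B)))"
proof -
  have form: "conjugate (col B j) \<bullet> (R *\<^sub>v col B j) = (\<Sum>i<m. \<Sum>k<m. R $$ (i, k) * (B $$ (k, j) * cnj (B $$ (i, j))))"
    if "j < m" for j
  proof -
    have "conjugate (col B j) \<bullet> (R *\<^sub>v col B j) = (\<Sum>i<m. cnj (B $$ (i, j)) * (\<Sum>k<m. R $$ (i, k) * B $$ (k, j)))"
      using R B that by (auto simp: scalar_prod_def atLeast0LessThan intro!: sum.cong)
    then show ?thesis by (simp add: sum_distrib_left ac_simps)
  qed
  have "mtrace (R * (B * adj B)) = (\<Sum>i<m. \<Sum>k<m. R $$ (i, k) * (B * adj B) $$ (k, i))"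
    using R B by (intro mtrace_mult) auto
  also have "\<dots> = (\<Sum>i<m. \<Sum>k<m. R $$ (i, k) * (\<Sum>j<m. B $$ (k, j) * cnj (B $$ (i, j))))"
  proof (intro sum.cong refl)
    fix i k assume "i \<in> {..<m}" "k \<in> {..<m}"
    then have ik: "i < m" "k < m" by auto
    have "(B * adj B) $$ (k, i) = (\<Sum>j<m. B $$ (k, j) * adj B $$ (j, i))"
      using B ik by (intro mult_index) auto
    then show "R $$ (i, k) * (B * adj B) $$ (k, i) = R $$ (i, k) * (\<Sum>j<m. B $$ (k, j) * cnj (B $$ (i, j)))"
      using B ik by (simp add: adj_index[of _ m])
  qed
  also have "\<dots> = (\<Sum>i<m. \<Sum>k<m. \<Sum>j<m. R $$ (i, k) * (B $$ (k, j) * cnj (B $$ (i, j))))"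
    by (simp add: sum_distrib_left)
  also have "\<dots> = (\<Sum>i<m. \<Sum>j<m. \<Sum>k<m. R $$ (i, k) * (B $$ (k, j) * cnj (B $$ (i, j))))"
    by (rule sum.cong[OF refl], rule sum.swap)
  also have "\<dots> = (\<Sum>j<m. \<Sum>i<m. \<Sum>k<m. R $$ (i, k) * (B $$ (k, j) * cnj (B $$ (i, j))))"
    by (rule sum.swap)
  also have "\<dots> = (\<Sum>j<m. conjugate (col B j) \<bullet> (R *\<^sub>v col B j))"
    by (intro sum.cong refl) (simp add: form)
  finally have "Re (mtrace (R * (B * adj B))) = (\<Sum>j<m. Re (conjugate (col B j) \<bullet> (R *\<^sub>v col B j)))"
    by simp
  also have "\<dots> \<ge> 0"
    using psd B by (intro sum_nonneg) (metis carrier_vecI carrier_matD(1) dim_col)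
  finally show ?thesis .
qed

text \<open>\<open>(1 \<plusminus> P)\<^sup>2 = 2 (1 \<plusminus> P)\<close>, so \<open>1 \<plusminus> P\<close> is positive semidefinite.\<close>
lemma density_mtrace_pauli_le:
  assumes "density_op (2 ^ n) R" "p \<in> pauli_labels n"
  shows "\<bar>Re (mtrace (R * pauli n p))\<bar> \<le> 1"
proof -
  let ?D = "2 ^ n :: nat" and ?P = "pauli n p"
  have R: "R \<in> carrier_mat ?D ?D" and tr: "mtrace R = 1"
    and psd: "\<forall>v\<in>carrier_vec ?D. 0 \<le> Re (conjugate v \<bullet> (R *\<^sub>v v))"
    using assms(1) by (auto simp: density_op_def)
  \<comment> \<open>The number \<open>s\<close> stands for the two signs: 1 gives the lower bound
    and -1 the upper one.\<close>
  have "0 \<le> 1 + s * Re (mtrace (R * ?P))" if s: "s * s = 1" for s :: real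
  proof -
    define B where "B = 1\<^sub>m ?D + complex_of_real s \<cdot>\<^sub>m ?P"
    have B: "B \<in> carrier_mat ?D ?D" by (simp add: B_def)
    have "adj B = 1\<^sub>m ?D + complex_of_real s \<cdot>\<^sub>m adj ?P"
      by (rule eq_matI) (auto simp: B_def adj_def)
    then have adjB: "adj B = B" by (simp add: B_def adj_pauli)
    have ss: "complex_of_real s * complex_of_real s = 1" using s by (simp flip: of_real_mult)
    have "B * B = (1\<^sub>m ?D + complex_of_real s \<cdot>\<^sub>m ?P)
        + complex_of_real s \<cdot>\<^sub>m (?P + complex_of_real s \<cdot>\<^sub>m 1\<^sub>m ?D)"
      unfolding B_def
      by (simp add: add_mult_distrib_mat[of _ ?D ?D _ _ ?D] mult_add_distrib_mat[of _ ?D ?D _ ?D]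
          mult_smult_distrib[of _ ?D ?D _ ?D] mult_smult_assoc_mat[of _ ?D ?D _ ?D] pauli_square assms(2))
    also have "\<dots> = 2 \<cdot>\<^sub>m 1\<^sub>m ?D + (2 * complex_of_real s) \<cdot>\<^sub>m ?P"
      by (rule eq_matI) (auto simp: algebra_simps ss)
    finally have BB: "B * B = 2 \<cdot>\<^sub>m 1\<^sub>m ?D + (2 * complex_of_real s) \<cdot>\<^sub>m ?P" .
    have "mtrace (R * (B * B)) = mtrace (2 \<cdot>\<^sub>m R + (2 * complex_of_real s) \<cdot>\<^sub>m (R * ?P))"
      unfolding BB using R
      by (simp add: mult_add_distrib_mat[of _ ?D ?D _ ?D] mult_smult_distrib[of _ ?D ?D _ ?D])
    also have "\<dots> = 2 * mtrace R + 2 * complex_of_real s * mtrace (R * ?P)"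
      using R by (simp add: mtrace_def sum.distrib sum_distrib_left)
    finally have "Re (mtrace (R * (B * B))) = 2 * (1 + s * Re (mtrace (R * ?P)))"
      by (simp add: tr)
    then show ?thesis using psd_mtrace[OF R B psd] by (simp add: adjB)
  qed
  from this[of 1] this[of "-1"] show ?thesis by simp
qed

text \<open>Expand \<open>P B P\<close> in the Pauli basis, where each \<open>P Q P\<close> is
  \<open>\<plusminus> Q\<close>. So the twisted function is, up to \<open>2 ^ n\<close>, the
  symplectic Fourier transform of \<open>Xi2\<close>, which turns the double sum with weight
  \<open>lcomm\<close> into \<open>pdot\<close>.\<close>

lemma Xi2t_eq:
  assumes A: "A \<in> carrier_mat (2 ^ n) (2 ^ n)" and B: "B \<in> carrier_mat (2 ^ n) (2 ^ n)" and p: "p \<in> pauli_labels n"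
  shows "2 ^ n * Xi2t n A B p = (\<Sum>q\<in>pauli_labels n. complex_of_real (lcomm n p q) * Xi2 n A B q)"
proof -
  let ?D = "2 ^ n :: nat" and ?L = "pauli_labels n" and ?P = "pauli n p"
  have entry: "2 ^ n * conj_by ?P B $$ (j, i)
      = (\<Sum>q\<in>?L. mtrace (B * pauli n q) * (complex_of_real (lcomm n p q) * pauli n q $$ (j, i)))"
    if "i < ?D" "j < ?D" for i j
  proof -
    have "conj_by ?P (pauli n q) $$ (j, i) = complex_of_real (lcomm n p q) * pauli n q $$ (j, i)" if "q \<in> ?L" for q
      using pauli_conj[OF p that] \<open>i < ?D\<close> \<open>j < ?D\<close> by (simp add: conj_by_def adj_pauli)
    then show ?thesis
      using conj_by_expansion[OF pauli_carrier B that(2,1), of p] by simp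
  qed
  have "A * ?P * B * ?P = A * conj_by ?P B"
    using A B by (simp add: conj_by_def adj_pauli assoc_mult_mat[of _ ?D ?D _ ?D _ ?D])
  then have "2 ^ n * Xi2t n A B p = 2 ^ n * (\<Sum>i<?D. \<Sum>j<?D. A $$ (i, j) * conj_by ?P B $$ (j, i))"
    unfolding Xi2t_def using A B by (simp add: mtrace_mult[of _ ?D])
  also have "\<dots> = (\<Sum>i<?D. \<Sum>j<?D. A $$ (i, j) * (2 ^ n * conj_by ?P B $$ (j, i)))"
    by (simp add: sum_distrib_left ac_simps)
  also have "\<dots> = (\<Sum>i<?D. \<Sum>j<?D. \<Sum>q\<in>?L. complex_of_real (lcomm n p q) * mtrace (B * pauli n q) * (A $$ (i, j) * pauli n q $$ (j, i)))"
    by (intro sum.cong refl) (simp add: entry sum_distrib_left ac_simps)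
  also have "\<dots> = (\<Sum>i<?D. \<Sum>q\<in>?L. \<Sum>j<?D. complex_of_real (lcomm n p q) * mtrace (B * pauli n q) * (A $$ (i, j) * pauli n q $$ (j, i)))"
    by (rule sum.cong[OF refl], rule sum.swap)
  also have "\<dots> = (\<Sum>q\<in>?L. \<Sum>i<?D. \<Sum>j<?D. complex_of_real (lcomm n p q) * mtrace (B * pauli n q) * (A $$ (i, j) * pauli n q $$ (j, i)))"
    by (rule sum.swap)
  also have "\<dots> = (\<Sum>q\<in>?L. complex_of_real (lcomm n p q) * Xi2 n A B q)"
    using A by (intro sum.cong refl) (simp add: Xi2_def mtrace_mult[of A ?D] sum_distrib_left ac_simps)
  finally show ?thesis .
qed

lemma hs_sq_eq:
  assumes "A \<in> carrier_mat m m" "hermitian A"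
  shows "complex_of_real (hs_sq A) = mtrace (A * A)"
proof -
  have "mtrace (A * A) = (\<Sum>i<m. \<Sum>j<m. A $$ (i, j) * cnj (A $$ (i, j)))"
    using assms by (simp add: mtrace_mult hermitian_index)
  then show ?thesis using assms(1) by (simp add: hs_sq_def complex_norm_square del: of_real_power)
qed

text \<open>The symmetric matrix \<open>lcomm\<close> is \<open>2 ^ n\<close> times an orthogonal one.\<close>
lemma symplectic_form_le:
  fixes y :: "(nat \<Rightarrow> nat) \<Rightarrow> real"
  shows "(\<Sum>p\<in>pauli_labels n. \<Sum>q\<in>pauli_labels n. lcomm n p q * (y p * y q))
    \<le> 2 ^ n * (\<Sum>p\<in>pauli_labels n. (y p)\<^sup>2)"
proof -
  let ?L = "pauli_labels n" and ?d = "2 ^ n :: real"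
  define z where "z p = (\<Sum>q\<in>?L. lcomm n p q * y q)" for p
  have "(\<Sum>p\<in>?L. (z p)\<^sup>2) = (\<Sum>p\<in>?L. \<Sum>q\<in>?L. \<Sum>r\<in>?L. y q * y r * (lcomm n p q * lcomm n p r))"
    by (simp add: z_def power2_eq_square sum_product ac_simps)
  also have "\<dots> = (\<Sum>q\<in>?L. \<Sum>r\<in>?L. \<Sum>p\<in>?L. y q * y r * (lcomm n p q * lcomm n p r))"
    by (subst sum.swap, rule sum.cong[OF refl], rule sum.swap)
  also have "\<dots> = (\<Sum>q\<in>?L. \<Sum>r\<in>?L. if r = q then y q * y r * ?d\<^sup>2 else 0)"
    by (intro sum.cong refl) (simp add: lcomm_orthogonal flip: sum_distrib_left)
  also have "\<dots> = ?d\<^sup>2 * (\<Sum>q\<in>?L. (y q)\<^sup>2)"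
    by (simp add: sum_distrib_left power2_eq_square ac_simps)
  finally have zz: "(\<Sum>p\<in>?L. (z p)\<^sup>2) = ?d\<^sup>2 * (\<Sum>q\<in>?L. (y q)\<^sup>2)" .
  have yz: "(\<Sum>p\<in>?L. y p * z p) = (\<Sum>p\<in>?L. \<Sum>q\<in>?L. lcomm n p q * (y p * y q))"
    by (simp add: z_def sum_distrib_left ac_simps)
  \<comment> \<open>Cauchy-Schwarz for \<open>y\<close> and \<open>z\<close> as an expanded square;
    \<open>?d\<close> is the right multiple because the norm of \<open>z\<close> is
    \<open>?d\<close> times that of \<open>y\<close>.\<close>
  have "0 \<le> (\<Sum>p\<in>?L. (?d * y p - z p)\<^sup>2)" by (intro sum_nonneg) simp
  also have "\<dots> = (\<Sum>p\<in>?L. ?d\<^sup>2 * (y p)\<^sup>2 + (z p)\<^sup>2 - 2 * ?d * (y p * z p))"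
    by (intro sum.cong refl) (simp add: power2_eq_square algebra_simps)
  also have "\<dots> = ?d\<^sup>2 * (\<Sum>p\<in>?L. (y p)\<^sup>2) + (\<Sum>p\<in>?L. (z p)\<^sup>2) - 2 * ?d * (\<Sum>p\<in>?L. y p * z p)"
    by (simp only: sum.distrib sum_subtractf sum_distrib_left)
  also have "\<dots> = 2 * ?d * (?d * (\<Sum>p\<in>?L. (y p)\<^sup>2) - (\<Sum>p\<in>?L. y p * z p))"
    unfolding zz by (simp only: power2_eq_square algebra_simps)
  finally show ?thesis unfolding yz by (simp add: zero_le_mult_iff power_le_zero_eq)
qed

theorem theorem3:
  fixes n :: nat and \<rho> Obs :: "complex mat"
  defines "d \<equiv> real (2^n)"
  assumes "n \<ge> 1"
    and "density_op (2^n) \<rho>"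
    and "Obs \<in> carrier_mat (2^n) (2^n)" and "hermitian Obs" and "mtrace Obs = 0"
  shows "V_star n Obs \<rho> = V_tri n Obs \<rho> - (Re (mtrace (Obs * \<rho>)))\<^sup>2 / (d + 2)
    \<and> V_tri n Obs \<rho> - (Re (mtrace (Obs * \<rho>)))\<^sup>2 / (d + 2) \<le> V_tri n Obs \<rho>
    \<and> V_tri n Obs \<rho> \<le> 2 * (d + 1) / (d * (d + 2)) * l2sq n (Xi2 n \<rho> Obs)
    \<and> 2 * (d + 1) / (d * (d + 2)) * l2sq n (Xi2 n \<rho> Obs) \<le> 2 * (d + 1) / (d + 2) * hs_sq Obs"
proof -
  note n = assms(2) and density = assms(3) and Obs = assms(4,5,6)
  have \<rho>: "\<rho> \<in> carrier_mat (2 ^ n) (2 ^ n)" "hermitian \<rho>"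
    using density by (auto simp: density_op_def)
  let ?L = "pauli_labels n"
  have d: "d = 2 ^ n" "d > 0" by (simp_all add: d_def)
  \<comment> \<open>All operators are Hermitian, so these traces are real and the inequalities can
    be proved over the reals.\<close>
  define a where "a p = Re (mtrace (\<rho> * pauli n p))" for p
  define b where "b p = Re (mtrace (Obs * pauli n p))" for p
  define y where "y p = a p * b p" for p
  define t where "t = Re (mtrace (Obs * \<rho>))"
  define Q where "Q = (\<Sum>p\<in>?L. (y p)\<^sup>2)"
  define T where "T = (\<Sum>p\<in>?L. \<Sum>q\<in>?L. lcomm n p q * (y p * y q))"
  have a: "mtrace (\<rho> * pauli n p) = complex_of_real (a p)" for p
    unfolding a_def by (rule Re_mtrace_hermitian[OF \<rho>(2) hermitian_pauli \<rho>(1) pauli_carrier, symmetric])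
  have b: "mtrace (Obs * pauli n p) = complex_of_real (b p)" for p
    unfolding b_def by (rule Re_mtrace_hermitian[OF Obs(2) hermitian_pauli Obs(1) pauli_carrier, symmetric])
  have x: "Xi2 n \<rho> Obs p = complex_of_real (y p)" for p
    by (simp add: Xi2_def a b y_def)
  \<comment> \<open>Parseval's identity turns the constant summand of the weight into the trace of
    \<open>Obs * \<rho>\<close>.\<close>
  have S: "(\<Sum>p\<in>?L. y p) = d * t"
  proof -
    have "complex_of_real (\<Sum>p\<in>?L. y p) = (\<Sum>p\<in>?L. mtrace (Obs * pauli n p) * mtrace (\<rho> * pauli n p))"
      by (simp add: a b y_def mult.commute)
    also have "\<dots> = 2 ^ n * mtrace (Obs * \<rho>)"
      by (rule sum_mtrace_pauli[OF Obs(1) \<rho>(1)])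
    also have "\<dots> = complex_of_real (d * t)"
      unfolding t_def d by (simp add: Re_mtrace_hermitian[OF Obs(2) \<rho>(2) Obs(1) \<rho>(1)])
    finally show ?thesis by (simp only: of_real_eq_iff)
  qed
  have l2: "l2sq n (Xi2 n \<rho> Obs) = Q"
    by (simp add: l2sq_def x Q_def)
  have pd: "pdot n (Xi2t n \<rho> Obs) (Xi2 n \<rho> Obs) = T / d"
  proof -
    have "Xi2t n \<rho> Obs p = complex_of_real ((\<Sum>q\<in>?L. lcomm n p q * y q) / d)" if "p \<in> ?L" for p
      using Xi2t_eq[OF \<rho>(1) Obs(1) that] d by (simp add: x field_simps)
    then have "pdot n (Xi2t n \<rho> Obs) (Xi2 n \<rho> Obs) = (\<Sum>p\<in>?L. (\<Sum>q\<in>?L. lcomm n p q * y q) / d * y p)"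
      unfolding pdot_def Re_sum by (intro sum.cong refl) (simp add: x)
    then show ?thesis
      by (simp add: T_def sum_distrib_left sum_distrib_right sum_divide_distrib ac_simps)
  qed
  have tri: "V_tri n Obs \<rho> = (d + 1) / (d * (d + 2)) * (Q + T / d)"
    by (simp add: V_tri_def l2 pd d)
  have "V_star n Obs \<rho> + t\<^sup>2 = Re (\<Sum>p\<in>?L. \<Sum>q\<in>?L.
      complex_of_real ((d + 1) / (d\<^sup>2 * (d + 2)) * (1 + lcomm n p q + (if p = q then d else 0))) * (complex_of_real (y p) * complex_of_real (y q)))"
    unfolding V_star_def second_moment[OF n \<rho>(1) Obs(1,3)] x t_def d(1) by simp
  also have "\<dots> = (\<Sum>p\<in>?L. \<Sum>q\<in>?L.
      (d + 1) / (d\<^sup>2 * (d + 2)) * (1 + lcomm n p q + (if p = q then d else 0)) * (y p * y q))"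
    unfolding Re_sum by (intro sum.cong refl) (simp only: Re_complex_of_real flip: of_real_mult)
  also have "\<dots> = (d + 1) / (d\<^sup>2 * (d + 2)) * (\<Sum>p\<in>?L. \<Sum>q\<in>?L.
      y p * y q + lcomm n p q * (y p * y q) + (if q = p then d * (y p * y q) else 0))"
    unfolding sum_distrib_left
    by (intro sum.cong refl, subst mult.assoc, rule arg_cong[where f = "(*) _"]) (simp add: distrib_right)
  \<comment> \<open>The constant, the character and the diagonal part of the weight, in this
    order.\<close>
  also have "(\<Sum>p\<in>?L. \<Sum>q\<in>?L. y p * y q + lcomm n p q * (y p * y q) + (if q = p then d * (y p * y q) else 0))
      = (d * t)\<^sup>2 + T + d * Q"
  proof -
    have "(d * t)\<^sup>2 = (\<Sum>p\<in>?L. \<Sum>q\<in>?L. y p * y q)"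
      by (simp only: S[symmetric] power2_eq_square sum_product)
    moreover have "d * Q = (\<Sum>p\<in>?L. \<Sum>q\<in>?L. if q = p then d * (y p * y q) else 0)"
      by (simp add: Q_def power2_eq_square sum_distrib_left)
    ultimately show ?thesis by (simp only: sum.distrib T_def)
  qed
  finally have star: "V_star n Obs \<rho> + t\<^sup>2 = (d + 1) / (d\<^sup>2 * (d + 2)) * ((d * t)\<^sup>2 + T + d * Q)" .
  \<comment> \<open>\<open>T\<close> and \<open>Q\<close> make up \<open>V_tri\<close>. The trace
    part is \<open>(d+1)/(d+2) * t^2 = t^2 - t^2/(d+2)\<close>, so subtracting \<open>t^2\<close>
    leaves the correction.\<close>
  have "V_star n Obs \<rho> = V_tri n Obs \<rho> - t\<^sup>2 / (d + 2)"
  proof -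
    have "d + 2 \<noteq> 0" "d \<noteq> 0" using d(2) by auto
    then have "(d + 1) / (d\<^sup>2 * (d + 2)) * ((d * t)\<^sup>2 + T + d * Q)
      = (d + 1) / (d * (d + 2)) * (Q + T / d) - t\<^sup>2 / (d + 2) + t\<^sup>2"
      by (simp add: divide_simps) (simp add: power2_eq_square algebra_simps)
    then show ?thesis using star tri by simp
  qed
  moreover have "V_tri n Obs \<rho> - t\<^sup>2 / (d + 2) \<le> V_tri n Obs \<rho>"
    using d(2) by simp
  moreover have "V_tri n Obs \<rho> \<le> 2 * (d + 1) / (d * (d + 2)) * Q"
  proof -
    \<comment> \<open>In terms of the Pauli functions: the twisted product is at most the squared
      norm, so the bracket in \<open>V_tri\<close> at most doubles that norm.\<close>
    have "T \<le> d * Q" unfolding T_def Q_def d(1) by (rule symplectic_form_le)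
    then have "T / d \<le> Q" using d(2) by (simp add: divide_le_eq mult.commute)
    then have "(d + 1) / (d * (d + 2)) * (Q + T / d) \<le> (d + 1) / (d * (d + 2)) * (2 * Q)"
      using d(2) by (intro mult_left_mono) auto
    also have "\<dots> = 2 * (d + 1) / (d * (d + 2)) * Q"
      by (simp only: divide_inverse ac_simps)
    finally show ?thesis unfolding tri .
  qed
  moreover have "2 * (d + 1) / (d * (d + 2)) * Q \<le> 2 * (d + 1) / (d + 2) * hs_sq Obs"
  proof -
    have "complex_of_real (\<Sum>p\<in>?L. (b p)\<^sup>2) = (\<Sum>p\<in>?L. mtrace (Obs * pauli n p) * mtrace (Obs * pauli n p))"
      by (simp add: b power2_eq_square)
    also have "\<dots> = complex_of_real (d * hs_sq Obs)"
      unfolding sum_mtrace_pauli[OF Obs(1) Obs(1)] hs_sq_eq[OF Obs(1,2), symmetric] d by simp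
    finally have bb: "(\<Sum>p\<in>?L. (b p)\<^sup>2) = d * hs_sq Obs" by (simp only: of_real_eq_iff)
    \<comment> \<open>Each Pauli coefficient of a density operator is at most 1 in absolute value,
      so dropping it only enlarges the sum.\<close>
    have "Q \<le> (\<Sum>p\<in>?L. (b p)\<^sup>2)" unfolding Q_def
    proof (rule sum_mono)
      fix p assume "p \<in> ?L"
      then have "\<bar>a p\<bar> \<le> 1" unfolding a_def by (rule density_mtrace_pauli_le[OF density])
      then have "(a p)\<^sup>2 \<le> 1" by (simp add: abs_square_le_1)
      then show "(y p)\<^sup>2 \<le> (b p)\<^sup>2"
        by (simp add: y_def power_mult_distrib mult_left_le_one_le)
    qed
    then have "2 * (d + 1) / (d * (d + 2)) * Q \<le> 2 * (d + 1) / (d * (d + 2)) * (d * hs_sq Obs)"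
      unfolding bb using d(2) by (intro mult_left_mono) auto
    then show ?thesis using d(2) by simp
  qed
  ultimately show ?thesis unfolding l2 t_def by blast
qed

end
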